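(* Let us assume that there exists a linear spectral problem (LSP) of the form $$D_j\Psi(\lambda,[u])-U_j(\lambda,[u])\Psi(\lambda,[u])=0,\qquad j=1,2,$$ associated with a SUSY integrable system of PDEs $\Delta[u]=0$, where $\Psi(\lambda,[u])\in GL(p\vert q,\mathbb{G})$, the $U_j(\lambda,[u])$ are fermionic supermatrices in $\mathfrak{gl}(p\vert q,\mathbb{G})$ and $\lambda$ is a spectral parameter, such that the zero-curvature condition (ZCC) $$D_1U_2+D_2U_1-\{EU_1,EU_2\}=0$$ is, for any value of $\lambda$, equivalent to $\Delta[u]=0$. Consider the bosonic infinitesimal deformations $$\tilde U_1=U_1+\epsilon A_1,\qquad \tilde U_2=U_2+\epsilon A_2,\qquad \tilde\Psi=\Psi(I+\epsilon F),$$ where $\epsilon$ is an infinitesimal bosonic parameter such that $\epsilon^2$ is negligible and $A_1(\lambda,[u]),A_2(\lambda,[u])$ are fermionic supermatrices in $\mathfrak{gl}(p\vert q,\mathbb{G})$, and suppose that these deformations preserve both the LSP and the ZCC, i.e. $A_1,A_2$ and $F$ must satisfy the deformed LSP $$D_j\tilde\Psi=\tilde U_j\tilde\Psi,\qquad j=1,2,$$ the tangent vector equations $$ED_j(F)=\Psi^{-1}EA_j\Psi,\qquad j=1,2,$$ and the deformed ZCC $$D_1A_2+D_2A_1-\{EA_1,EU_2\}-\{EA_2,EU_1\}=0.$$ Then there exists an immersion bosonic supermatrix $F(\lambda,[u])$ in $\mathfrak{gl}(p\vert q,\mathbb{G})$ which defines a 2D surface, provided that its tangent vectors $ED_j(F)=\Psi^{-1}EA_j\Psi$,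 $j=1,2$, are linearly independent.
   Context: $\mathbb{G}$ is a complex Grassmann algebra generated by the unit and (sufficiently many) anticommuting odd generators, graded by parity; "even/odd" is synonymous with "bosonic/fermionic". A square $(p+q)\times(p+q)$ supermatrix $M=\begin{pmatrix}A&B\\C&D\end{pmatrix}$ ($A$ of size $p\times p$, $D$ of size $q\times q$) is even (bosonic) if the entries of $A,D$ are even and those of $B,C$ are odd, and odd (fermionic) if the entries of $A,D$ are odd and those of $B,C$ are even. $\mathfrak{gl}(p\vert q,\mathbb{G})$ is the Lie superalgebra of such supermatrices and $GL(p\vert q,\mathbb{G})$ is the Lie supergroup of invertible even ones. $I$ is the identity matrix, $E=\begin{pmatrix}I_p&0\\0&-I_q\end{pmatrix}$, and $\{M,N\}=MN+NM$. The system $\Delta[u]=0$ is in terms of the bosonic independent variables $x_1,x_2$, the fermionic independent variables $\theta^1,\theta^2$, and the SUSY dependent variables $u^k$ and their derivatives; $[u]$ denotes the collection of independent variables, dependent variables and derivatives of the latter. The covariant derivatives are $D_j=\partial_{\theta^j}-i\theta^j\partial_{x_j}$, $j=1,2$; they satisfy $\{D_1,D_2\}=0$ and $D_j^2=-i\partial_{x_j}$. Odd derivatives satisfy $\partial_{\theta^j}(hg)=(\partial_{\theta^j}h)g+(-1)^{\deg h}h\,\partial_{\theta^j}g$. Odd derivatives and odd scalars act on supermatrices entrywise, with no implicit sign inserted in the lower blocks (signs are put in explicitly through $E$). The supermatrix $F$ is called the deformed surface and $ED_1(F),ED_2(F)$ are its tangent vectors.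
   Formalization: The bosonic variables (x_1,x_2) are taken to range over an open simply connected domain of the real plane; on a domain with a hole the tangent vector equations may have no single-valued solution F. *)

theory Defs
  imports "HOL-Analysis.Analysis" "Jordan_Normal_Form.Matrix"
begin

text \<open>An element of the complex Grassmann algebra on the anticommuting generators \<open>g :: 'g\<close> is given
  by its coefficients with respect to the monomials \<open>e\<^sub>S\<close>, where \<open>e\<^sub>S\<close> is the product of the
  generators in \<open>S\<close>, taken in increasing order. The algebra is only considered for finite,
  linearly ordered \<open>'g\<close>.\<close>

typedef 'g grassmann = "UNIV :: ('g set \<Rightarrow> complex) set"
  morphisms gcoeff Grassmann ..

lemma gcoeff_Grassmann [simp]: "gcoeff (Grassmann f) = f"
  by (simp add: Grassmann_inverse)

lemma grassmann_eqI: "(\<And>S. gcoeff a S = gcoeff b S) \<Longrightarrow> a = b"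
  by (metis gcoeff_inverse ext)

text \<open>For disjoint \<open>S\<close> and \<open>T\<close> one has \<open>e\<^sub>S e\<^sub>T = gsign S T \<cdot> e\<close>, where \<open>e\<close> is the monomial of \<open>S \<union> T\<close>.\<close>

definition gsign :: "'g::linorder set \<Rightarrow> 'g set \<Rightarrow> complex" where
  "gsign S T = (-1) ^ card {(s, t). s \<in> S \<and> t \<in> T \<and> t < s}"

lemma gsign_empty [simp]: "gsign {} T = 1" "gsign S {} = 1"
  by (simp_all add: gsign_def)

lemma gsign_Un_left:
  fixes A B C :: "'g::{finite,linorder} set"
  assumes "A \<inter> B = {}"
  shows "gsign (A \<union> B) C = gsign A C * gsign B C"
proof -
  have "{(s, t). s \<in> A \<union> B \<and> t \<in> C \<and> t < s} =
        {(s, t). s \<in> A \<and> t \<in> C \<and> t < s} \<union> {(s, t). s \<in> B \<and> t \<in> C \<and> t < s}"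
    by auto
  moreover have "{(s, t). s \<in> A \<and> t \<in> C \<and> t < s} \<inter> {(s, t). s \<in> B \<and> t \<in> C \<and> t < s} = {}"
    using assms by auto
  ultimately show ?thesis
    by (simp add: gsign_def card_Un_disjoint power_add)
qed

lemma gsign_Un_right:
  fixes A B C :: "'g::{finite,linorder} set"
  assumes "B \<inter> C = {}"
  shows "gsign A (B \<union> C) = gsign A B * gsign A C"
proof -
  have "{(s, t). s \<in> A \<and> t \<in> B \<union> C \<and> t < s} =
        {(s, t). s \<in> A \<and> t \<in> B \<and> t < s} \<union> {(s, t). s \<in> A \<and> t \<in> C \<and> t < s}"
    by auto
  moreover have "{(s, t). s \<in> A \<and> t \<in> B \<and> t < s} \<inter> {(s, t). s \<in> A \<and> t \<in> C \<and> t < s} = {}"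
    using assms by auto
  ultimately show ?thesis
    by (simp add: gsign_def card_Un_disjoint power_add)
qed

instantiation grassmann :: ("{finite,linorder}") ring_1
begin

definition zero_grassmann :: "'a grassmann" where
  "0 = Grassmann (\<lambda>_. 0)"

definition one_grassmann :: "'a grassmann" where
  "1 = Grassmann (\<lambda>S. if S = {} then 1 else 0)"

definition plus_grassmann :: "'a grassmann \<Rightarrow> 'a grassmann \<Rightarrow> 'a grassmann" where
  "a + b = Grassmann (\<lambda>S. gcoeff a S + gcoeff b S)"

definition minus_grassmann :: "'a grassmann \<Rightarrow> 'a grassmann \<Rightarrow> 'a grassmann" where
  "a - b = Grassmann (\<lambda>S. gcoeff a S - gcoeff b S)"

definition uminus_grassmann :: "'a grassmann \<Rightarrow> 'a grassmann" where
  "- a = Grassmann (\<lambda>S. - gcoeff a S)"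

definition times_grassmann :: "'a grassmann \<Rightarrow> 'a grassmann \<Rightarrow> 'a grassmann" where
  "a * b = Grassmann (\<lambda>S. \<Sum>T\<in>Pow S. gsign T (S - T) * gcoeff a T * gcoeff b (S - T))"

lemma gcoeff_times_assoc:
  fixes a b c :: "'a grassmann"
  shows "gcoeff (a * b * c) S = gcoeff (a * (b * c)) S"
proof -
  let ?l = "\<lambda>W T. gsign W (S - W) * (gsign T (W - T) * gcoeff a T * gcoeff b (W - T)) * gcoeff c (S - W)"
  let ?r = "\<lambda>T V. gsign T (S - T) * gcoeff a T *
              (gsign V (S - T - V) * gcoeff b V * gcoeff c (S - T - V))"
  have "gcoeff (a * b * c) S = (\<Sum>W\<in>Pow S. \<Sum>T\<in>Pow W. ?l W T)"
    by (simp add: times_grassmann_def sum_distrib_left sum_distrib_right)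
  also have "\<dots> = (\<Sum>(W, T)\<in>(SIGMA W:Pow S. Pow W). ?l W T)"
    by (simp add: sum.Sigma)
  also have "\<dots> = (\<Sum>(T, V)\<in>(SIGMA T:Pow S. Pow (S - T)). ?r T V)"
  proof (rule sum.reindex_bij_witness
      [where i = "\<lambda>(T, V). (T \<union> V, T)" and j = "\<lambda>(W, T). (T, W - T)"], goal_cases)
    case (5 z)
    obtain W T where z: "z = (W, T)" by (cases z)
    have WT: "W \<subseteq> S" "T \<subseteq> W" using 5 z by auto
    have 1: "S - T - (W - T) = S - W" using WT by blast
    have "gsign W (S - W) = gsign T (S - W) * gsign (W - T) (S - W)"
      using gsign_Un_left[of T "W - T" "S - W"] WT by (simp add: Un_absorb1)
    moreover have "gsign T (S - T) = gsign T (W - T) * gsign T (S - W)"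
    proof -
      have "S - T = (W - T) \<union> (S - W)" using WT by blast
      then show ?thesis using gsign_Un_right[of "W - T" "S - W" T] by fastforce
    qed
    ultimately show ?case by (simp add: z 1)
  qed auto
  also have "\<dots> = (\<Sum>T\<in>Pow S. \<Sum>V\<in>Pow (S - T). ?r T V)"
    by (simp add: sum.Sigma)
  also have "\<dots> = gcoeff (a * (b * c)) S"
    by (simp add: times_grassmann_def sum_distrib_left)
  finally show ?thesis .
qed

instance
proof
  fix a b c :: "'a grassmann"
  show "a * b * c = a * (b * c)"
    by (rule grassmann_eqI) (rule gcoeff_times_assoc)
  show "1 * a = a"
  proof (rule grassmann_eqI)
    fix S
    have "gcoeff (1 * a) S = (\<Sum>T\<in>Pow S. if T = {} then gcoeff a S else 0)"
      unfolding times_grassmann_def one_grassmann_def gcoeff_Grassmann by (rule sum.cong) auto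
    then show "gcoeff (1 * a) S = gcoeff a S"
      by (simp add: sum.delta)
  qed
  show "a * 1 = a"
  proof (rule grassmann_eqI)
    fix S
    have "gcoeff (a * 1) S = (\<Sum>T\<in>Pow S. if T = S then gcoeff a S else 0)"
      unfolding times_grassmann_def one_grassmann_def gcoeff_Grassmann by (rule sum.cong) auto
    then show "gcoeff (a * 1) S = gcoeff a S"
      by (simp add: sum.delta)
  qed
  show "(0 :: 'a grassmann) \<noteq> 1"
  proof
    assume "(0 :: 'a grassmann) = 1"
    then have "gcoeff (0 :: 'a grassmann) {} = gcoeff 1 {}" by simp
    then show False by (simp add: zero_grassmann_def one_grassmann_def)
  qed
qed (auto intro!: grassmann_eqI simp: plus_grassmann_def zero_grassmann_def uminus_grassmann_def
      minus_grassmann_def times_grassmann_def algebra_simps sum.distrib)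

end

definition gconst :: "complex \<Rightarrow> 'g grassmann" where
  "gconst z = Grassmann (\<lambda>S. if S = {} then z else 0)"

definition ggen :: "'g \<Rightarrow> 'g grassmann" where
  "ggen g = Grassmann (\<lambda>S. if S = {g} then 1 else 0)"

definition even_elem :: "'g grassmann \<Rightarrow> bool" where
  "even_elem a \<longleftrightarrow> (\<forall>S. odd (card S) \<longrightarrow> gcoeff a S = 0)"

definition odd_elem :: "'g grassmann \<Rightarrow> bool" where
  "odd_elem a \<longleftrightarrow> (\<forall>S. even (card S) \<longrightarrow> gcoeff a S = 0)"

text \<open>The left derivative: \<open>g\<close> is moved to the front of each monomial containing it and removed.
  This is the odd derivation sending the generator \<open>g\<close> to \<open>1\<close> and the other generators to \<open>0\<close>.\<close>

definition gderiv :: "'g::linorder \<Rightarrow> 'g grassmann \<Rightarrow> 'g grassmann" where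
  "gderiv g a = Grassmann (\<lambda>S. if g \<in> S then 0 else gsign {g} S * gcoeff a (insert g S))"

text \<open>The bosonic variables are \<open>(x\<^sub>1, x\<^sub>2) \<in> \<real>\<^sup>2\<close>. The fermionic variables \<open>\<theta>\<^sup>1, \<theta>\<^sup>2\<close> are two distinct
  generators \<open>th 1, th 2\<close> of the Grassmann algebra, so that the values of a superfield
  contain its expansion in \<open>\<theta>\<^sup>1, \<theta>\<^sup>2\<close>; the other generators are odd parameters.\<close>

type_synonym point = "real \<times> real"
type_synonym 'g sfield = "point \<Rightarrow> 'g grassmann"

primrec Ck_on :: "nat \<Rightarrow> point set \<Rightarrow> (point \<Rightarrow> complex) \<Rightarrow> bool" where
  "Ck_on 0 \<Omega> f \<longleftrightarrow> continuous_on \<Omega> f"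
| "Ck_on (Suc k) \<Omega> f \<longleftrightarrow> (\<forall>x\<in>\<Omega>. f differentiable (at x)) \<and>
     (\<forall>v. Ck_on k \<Omega> (\<lambda>x. frechet_derivative f (at x) v))"

definition smooth_on :: "point set \<Rightarrow> 'g sfield \<Rightarrow> bool" where
  "smooth_on \<Omega> f \<longleftrightarrow> (\<forall>S k. Ck_on k \<Omega> (\<lambda>x. gcoeff (f x) S))"

definition dir :: "nat \<Rightarrow> point" where
  "dir j = (if j = 1 then (1, 0) else (0, 1))"

definition pd_x :: "nat \<Rightarrow> 'g sfield \<Rightarrow> 'g sfield" where
  "pd_x j f = (\<lambda>x. Grassmann (\<lambda>S. frechet_derivative (\<lambda>y. gcoeff (f y) S) (at x) (dir j)))"

definition pd_theta :: "(nat \<Rightarrow> 'g::linorder) \<Rightarrow> nat \<Rightarrow> 'g sfield \<Rightarrow> 'g sfield" where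
  "pd_theta th j f = (\<lambda>x. gderiv (th j) (f x))"

definition covD :: "(nat \<Rightarrow> 'g::{finite,linorder}) \<Rightarrow> nat \<Rightarrow> 'g sfield \<Rightarrow> 'g sfield" where
  "covD th j f = (\<lambda>x. pd_theta th j f x - gconst \<i> * ggen (th j) * pd_x j f x)"

type_synonym 'g smfield = "point \<Rightarrow> 'g grassmann mat"

text \<open>The index \<open>i\<close> belongs to the first block iff \<open>i < p\<close>.\<close>

definition bosonic_mat :: "nat \<Rightarrow> nat \<Rightarrow> 'g grassmann mat \<Rightarrow> bool" where
  "bosonic_mat p q M \<longleftrightarrow> M \<in> carrier_mat (p + q) (p + q) \<and>
     (\<forall>i<p + q. \<forall>j<p + q. if i < p \<longleftrightarrow> j < p then even_elem (M $$ (i, j)) else odd_elem (M $$ (i, j)))"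

definition fermionic_mat :: "nat \<Rightarrow> nat \<Rightarrow> 'g grassmann mat \<Rightarrow> bool" where
  "fermionic_mat p q M \<longleftrightarrow> M \<in> carrier_mat (p + q) (p + q) \<and>
     (\<forall>i<p + q. \<forall>j<p + q. if i < p \<longleftrightarrow> j < p then odd_elem (M $$ (i, j)) else even_elem (M $$ (i, j)))"

definition GL_mat :: "nat \<Rightarrow> nat \<Rightarrow> 'g::{finite,linorder} grassmann mat \<Rightarrow> bool" where
  "GL_mat p q M \<longleftrightarrow> bosonic_mat p q M \<and> invertible_mat M"

definition mat_inv :: "'g::{finite,linorder} grassmann mat \<Rightarrow> 'g grassmann mat" where
  "mat_inv M = (THE N. N \<in> carrier_mat (dim_row M) (dim_row M) \<and> inverts_mat M N \<and> inverts_mat N M)"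

definition Emat :: "nat \<Rightarrow> nat \<Rightarrow> 'g::{finite,linorder} grassmann mat" where
  "Emat p q = four_block_mat (1\<^sub>m p) (0\<^sub>m p q) (0\<^sub>m q p) (- 1\<^sub>m q)"

definition smooth_mat_on :: "point set \<Rightarrow> nat \<Rightarrow> nat \<Rightarrow> 'g smfield \<Rightarrow> bool" where
  "smooth_mat_on \<Omega> p q M \<longleftrightarrow> (\<forall>i<p + q. \<forall>j<p + q. smooth_on \<Omega> (\<lambda>x. M x $$ (i, j)))"

definition bosonic_on :: "point set \<Rightarrow> nat \<Rightarrow> nat \<Rightarrow> 'g smfield \<Rightarrow> bool" where
  "bosonic_on \<Omega> p q M \<longleftrightarrow> smooth_mat_on \<Omega> p q M \<and> (\<forall>x\<in>\<Omega>. bosonic_mat p q (M x))"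

definition fermionic_on :: "point set \<Rightarrow> nat \<Rightarrow> nat \<Rightarrow> 'g smfield \<Rightarrow> bool" where
  "fermionic_on \<Omega> p q M \<longleftrightarrow> smooth_mat_on \<Omega> p q M \<and> (\<forall>x\<in>\<Omega>. fermionic_mat p q (M x))"

definition GL_on :: "point set \<Rightarrow> nat \<Rightarrow> nat \<Rightarrow> 'g::{finite,linorder} smfield \<Rightarrow> bool" where
  "GL_on \<Omega> p q M \<longleftrightarrow> smooth_mat_on \<Omega> p q M \<and> (\<forall>x\<in>\<Omega>. GL_mat p q (M x))"

definition covD_mat :: "(nat \<Rightarrow> 'g::{finite,linorder}) \<Rightarrow> nat \<Rightarrow> 'g smfield \<Rightarrow> 'g smfield" where
  "covD_mat th j M = (\<lambda>x. mat (dim_row (M x)) (dim_col (M x))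
     (\<lambda>(a, b). covD th j (\<lambda>y. M y $$ (a, b)) x))"

definition acomm :: "'a::ring_1 mat \<Rightarrow> 'a mat \<Rightarrow> 'a mat" where
  "acomm M N = M * N + N * M"

text \<open>\<open>[u]\<close> consists of the bosonic variables and of all derivatives
  \<open>\<partial>\<^bsub>x\<^sub>1\<^esub>\<^bsup>m\<^sub>1\<^esup> \<partial>\<^bsub>x\<^sub>2\<^esub>\<^bsup>m\<^sub>2\<^esup> \<partial>\<^bsub>\<theta>\<^sup>1\<^esub>\<^bsup>s\<^sub>1\<^esup> \<partial>\<^bsub>\<theta>\<^sup>2\<^esub>\<^bsup>s\<^sub>2\<^esup> u\<^sup>k\<close>, order zero included. The variables \<open>\<theta>\<^sup>1, \<theta>\<^sup>2\<close> need no
  argument of their own, being elements of the algebra in which functions of \<open>[u]\<close> take values.\<close>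

type_synonym ('k, 'g) jet = "point \<times> ('k \<Rightarrow> nat \<Rightarrow> nat \<Rightarrow> nat \<Rightarrow> nat \<Rightarrow> 'g grassmann)"

definition jet :: "(nat \<Rightarrow> 'g::linorder) \<Rightarrow> ('k \<Rightarrow> 'g sfield) \<Rightarrow> point \<Rightarrow> ('k, 'g) jet" where
  "jet th u x = (x, \<lambda>k m1 m2 s1 s2.
     (pd_x 1 ^^ m1) ((pd_x 2 ^^ m2) ((pd_theta th 1 ^^ s1) ((pd_theta th 2 ^^ s2) (u k)))) x)"

definition along :: "(nat \<Rightarrow> 'g::linorder) \<Rightarrow> ('k \<Rightarrow> 'g sfield) \<Rightarrow> (('k, 'g) jet \<Rightarrow> 'b) \<Rightarrow> point \<Rightarrow> 'b" where
  "along th u \<Phi> = (\<lambda>x. \<Phi> (jet th u x))"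

text \<open>The superfield \<open>u\<^sup>k\<close> is fermionic if \<open>fermi k\<close> holds and bosonic otherwise.\<close>

definition field_configs :: "point set \<Rightarrow> ('k \<Rightarrow> bool) \<Rightarrow> ('k \<Rightarrow> 'g sfield) set" where
  "field_configs \<Omega> fermi = {u. \<forall>k. smooth_on \<Omega> (u k) \<and>
     (\<forall>x\<in>\<Omega>. if fermi k then odd_elem (u k x) else even_elem (u k x))}"

definition solves :: "point set \<Rightarrow> (nat \<Rightarrow> 'g::{finite,linorder}) \<Rightarrow>
    ('e \<Rightarrow> ('k, 'g) jet \<Rightarrow> 'g grassmann) \<Rightarrow> ('k \<Rightarrow> 'g sfield) \<Rightarrow> bool" where
  "solves \<Omega> th \<Delta> u \<longleftrightarrow> (\<forall>e. \<forall>x\<in>\<Omega>. along th u (\<Delta> e) x = 0)"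

definition LSP :: "point set \<Rightarrow> nat \<Rightarrow> nat \<Rightarrow> (nat \<Rightarrow> 'g::{finite,linorder}) \<Rightarrow>
    (nat \<Rightarrow> 'g smfield) \<Rightarrow> 'g smfield \<Rightarrow> bool" where
  "LSP \<Omega> p q th U \<Psi> \<longleftrightarrow>
     (\<forall>j\<in>{1, 2}. \<forall>x\<in>\<Omega>. covD_mat th j \<Psi> x - U j x * \<Psi> x = 0\<^sub>m (p + q) (p + q))"

definition ZCC :: "point set \<Rightarrow> nat \<Rightarrow> nat \<Rightarrow> (nat \<Rightarrow> 'g::{finite,linorder}) \<Rightarrow>
    (nat \<Rightarrow> 'g smfield) \<Rightarrow> bool" where
  "ZCC \<Omega> p q th U \<longleftrightarrow> (\<forall>x\<in>\<Omega>.
     covD_mat th 1 (U 2) x + covD_mat th 2 (U 1) x - acomm (Emat p q * U 1 x) (Emat p q * U 2 x)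
       = 0\<^sub>m (p + q) (p + q))"

definition deformed_ZCC :: "point set \<Rightarrow> nat \<Rightarrow> nat \<Rightarrow> (nat \<Rightarrow> 'g::{finite,linorder}) \<Rightarrow>
    (nat \<Rightarrow> 'g smfield) \<Rightarrow> (nat \<Rightarrow> 'g smfield) \<Rightarrow> bool" where
  "deformed_ZCC \<Omega> p q th U A \<longleftrightarrow> (\<forall>x\<in>\<Omega>.
     covD_mat th 1 (A 2) x + covD_mat th 2 (A 1) x
       - acomm (Emat p q * A 1 x) (Emat p q * U 2 x)
       - acomm (Emat p q * A 2 x) (Emat p q * U 1 x)
       = 0\<^sub>m (p + q) (p + q))"

text \<open>The pair \<open>(M, N)\<close> stands for \<open>M + \<epsilon> N\<close>, where \<open>\<epsilon>\<close> is even and \<open>\<epsilon>\<^sup>2 = 0\<close>.\<close>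

type_synonym 'g eps_smfield = "'g smfield \<times> 'g smfield"

definition eps_mult :: "'g::{finite,linorder} eps_smfield \<Rightarrow> 'g eps_smfield \<Rightarrow> 'g eps_smfield" where
  "eps_mult M N = (\<lambda>x. fst M x * fst N x, \<lambda>x. fst M x * snd N x + snd M x * fst N x)"

definition eps_covD :: "(nat \<Rightarrow> 'g::{finite,linorder}) \<Rightarrow> nat \<Rightarrow> 'g eps_smfield \<Rightarrow> 'g eps_smfield" where
  "eps_covD th j M = (covD_mat th j (fst M), covD_mat th j (snd M))"

definition eps_eq_on :: "point set \<Rightarrow> 'g eps_smfield \<Rightarrow> 'g eps_smfield \<Rightarrow> bool" where
  "eps_eq_on \<Omega> M N \<longleftrightarrow> (\<forall>x\<in>\<Omega>. fst M x = fst N x \<and> snd M x = snd N x)"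

definition deformed_LSP :: "point set \<Rightarrow> nat \<Rightarrow> nat \<Rightarrow> (nat \<Rightarrow> 'g::{finite,linorder}) \<Rightarrow>
    (nat \<Rightarrow> 'g smfield) \<Rightarrow> (nat \<Rightarrow> 'g smfield) \<Rightarrow> 'g smfield \<Rightarrow> 'g smfield \<Rightarrow> bool" where
  "deformed_LSP \<Omega> p q th U A \<Psi> F \<longleftrightarrow>
     (let \<Psi>' = eps_mult (\<Psi>, \<lambda>_. 0\<^sub>m (p + q) (p + q)) (\<lambda>_. 1\<^sub>m (p + q), F)
      in \<forall>j\<in>{1, 2}. eps_eq_on \<Omega> (eps_covD th j \<Psi>') (eps_mult (U j, A j) \<Psi>'))"

definition tangent_vector :: "nat \<Rightarrow> nat \<Rightarrow> (nat \<Rightarrow> 'g::{finite,linorder}) \<Rightarrow> nat \<Rightarrow> 'g smfield \<Rightarrow> 'g smfield" where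
  "tangent_vector p q th j F = (\<lambda>x. Emat p q * covD_mat th j F x)"

definition tangent_rhs :: "nat \<Rightarrow> nat \<Rightarrow> 'g::{finite,linorder} smfield \<Rightarrow> 'g smfield \<Rightarrow> 'g smfield" where
  "tangent_rhs p q \<Psi> A = (\<lambda>x. mat_inv (\<Psi> x) * Emat p q * A x * \<Psi> x)"

text \<open>Scalars of the Grassmann algebra multiply supermatrices entrywise from the left.\<close>

definition lin_indep2 :: "nat \<Rightarrow> 'g::{finite,linorder} grassmann mat \<Rightarrow> 'g grassmann mat \<Rightarrow> bool" where
  "lin_indep2 n V W \<longleftrightarrow> (\<forall>a b. a \<cdot>\<^sub>m V + b \<cdot>\<^sub>m W = 0\<^sub>m n n \<longrightarrow> a = 0 \<and> b = 0)"

text \<open>\<open>F\<close> immerses the superspace along the two directions \<open>D\<^sub>1, D\<^sub>2\<close>: at every point the tangent map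
  \<open>(a\<^sub>1, a\<^sub>2) \<mapsto> a\<^sub>1 E D\<^sub>1F + a\<^sub>2 E D\<^sub>2F\<close> is injective.\<close>

definition tangent_map :: "nat \<Rightarrow> nat \<Rightarrow> (nat \<Rightarrow> 'g::{finite,linorder}) \<Rightarrow> 'g smfield \<Rightarrow> point \<Rightarrow>
    'g grassmann \<times> 'g grassmann \<Rightarrow> 'g grassmann mat" where
  "tangent_map p q th F x = (\<lambda>(a1, a2).
     a1 \<cdot>\<^sub>m tangent_vector p q th 1 F x + a2 \<cdot>\<^sub>m tangent_vector p q th 2 F x)"

definition immersed_surface :: "point set \<Rightarrow> nat \<Rightarrow> nat \<Rightarrow> (nat \<Rightarrow> 'g::{finite,linorder}) \<Rightarrow> 'g smfield \<Rightarrow> bool" where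
  "immersed_surface \<Omega> p q th F \<longleftrightarrow> bosonic_on \<Omega> p q F \<and> (\<forall>x\<in>\<Omega>. inj (tangent_map p q th F x))"

end

theory Submission
  imports Defs "HOL-Complex_Analysis.Riemann_Mapping" "Jordan_Normal_Form.Determinant"
begin

text \<open>The tangent vector equations read \<open>D\<^sub>j F = B\<^sub>j\<close> with \<open>B\<^sub>j = E \<Psi>\<^sup>-\<^sup>1 E A\<^sub>j \<Psi>\<close>. Since \<open>D\<^sub>1\<close> and \<open>D\<^sub>2\<close> anticommute,
  they require \<open>D\<^sub>1 B\<^sub>2 + D\<^sub>2 B\<^sub>1 = 0\<close>, and \<open>\<Psi> (D\<^sub>1 B\<^sub>2 + D\<^sub>2 B\<^sub>1) \<Psi>\<^sup>-\<^sup>1\<close> turns out to be the left-hand side of the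
  deformed ZCC. Conversely this condition suffices: expanding in \<open>\<theta>\<^sup>1, \<theta>\<^sup>2\<close>, it determines all components
  of \<open>F\<close> but the lowest one algebraically, and says that the remaining component has to be a primitive of a
  closed 1-form on \<open>\<Omega>\<close>, which exists because \<open>\<Omega>\<close> is simply connected. The grade involution
  \<open>gbar\<close> carries all parity bookkeeping: \<open>D\<^sub>j\<close> satisfies \<open>D\<^sub>j (M N) = D\<^sub>j M N + gbar M D\<^sub>j N\<close>, and \<open>M\<close> is
  bosonic (fermionic) iff \<open>gbar M\<close> is \<open>E M E\<close> (\<open>- E M E\<close>).\<close>

section \<open>Closed 1-forms on simply connected plane domains\<close>

text \<open>Order epsilon of the deformed LSP carries the same information as the tangent vector
  equations: since D_j(Psi F) = U_j Psi F + (E Psi E) D_j F, it reduces to (E Psi E) D_j F = A_j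
  Psi. One potential therefore serves both requirements. Two obstacles shape the rest. Only Psi is
  assumed smooth, while the right-hand sides contain its inverse; the Grassmann algebra is not
  commutative, so Cramer's rule reaches only the degree-zero part of Psi, and higher degrees need
  their own argument. Moreover, a potential found by integration comes without a parity. Each D_j
  reverses parity, so the component of the wrong parity can be projected away without disturbing the
  equations, and this makes F bosonic.\<close>

lemma closed_form_has_primitive_convex:
  fixes w :: "'a::euclidean_space \<Rightarrow> 'a \<Rightarrow>\<^sub>L 'b::banach"
    and w' :: "'a \<Rightarrow> 'a \<Rightarrow>\<^sub>L ('a \<Rightarrow>\<^sub>L 'b)"
  assumes "convex U" "open U"
    and deriv: "\<And>x. x \<in> U \<Longrightarrow> (w has_derivative w' x) (at x)"
    and cont: "continuous_on U w'"
    and symm: "\<And>x u v. x \<in> U \<Longrightarrow> w' x u v = w' x v u"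
  shows "\<exists>h. \<forall>x\<in>U. (h has_derivative w x) (at x)"
proof (cases "U = {}")
  case False
  then obtain c where c: "c \<in> U" by blast
  define \<gamma> where "\<gamma> = (\<lambda>x t. c + t *\<^sub>R (x - c))"
  have \<gamma>: "\<gamma> x t \<in> U" if "x \<in> U" "t \<in> {0..1::real}" for x t
  proof -
    have "\<gamma> x t = (1 - t) *\<^sub>R c + t *\<^sub>R x"
      by (simp add: \<gamma>_def algebra_simps)
    then show ?thesis
      using \<open>convex U\<close> c that by (simp add: convexD_alt)
  qed
  have contw: "continuous_on U w"
    by (meson deriv has_derivative_continuous continuous_at_imp_continuous_on)
  \<comment> \<open>\<open>h\<close> integrates \<open>w\<close> along the segment from
    \<open>c\<close> to \<open>x\<close>. \<open>fx\<close> is the derivative of the integrand in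
    \<open>x\<close>, with the arguments of \<open>w'\<close> already interchanged by symmetry; in
    this form it is the \<open>t\<close>-derivative of \<open>t *\<^sub>R w (\<gamma> x t)\<close>
    and integrates to \<open>w x\<close>.\<close>
  define fx where "fx = (\<lambda>x t. t *\<^sub>R blinfun_apply (w' (\<gamma> x t)) (x - c) + w (\<gamma> x t))"
  define h where "h = (\<lambda>x. integral (cbox 0 1) (\<lambda>t. w (\<gamma> x t) (x - c)))"
  have "(h has_derivative w x) (at x)" if x: "x \<in> U" for x
  proof -
    have "(h has_derivative integral (cbox 0 1) (fx x)) (at x within U)"
      unfolding h_def
    proof (rule leibniz_rule)
      fix y t assume y: "y \<in> U" and t: "t \<in> cbox 0 (1::real)"
      have "((\<lambda>x. w (\<gamma> x t)) has_derivative (\<lambda>v. w' (\<gamma> y t) (t *\<^sub>R v))) (at y within U)"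
        using \<gamma>[OF y] t unfolding \<gamma>_def
        by (intro has_derivative_compose[where g = w, OF _ deriv]) (auto intro!: derivative_eq_intros)
      then have hd: "((\<lambda>x. w (\<gamma> x t) (x - c)) has_derivative
          (\<lambda>v. w (\<gamma> y t) v + w' (\<gamma> y t) (t *\<^sub>R v) (y - c))) (at y within U)"
        by (intro derivative_eq_intros | simp)+
      \<comment> \<open>Closedness enters here: the direction of differentiation and the argument of
        the form change places.\<close>
      have sy: "w' (\<gamma> y t) (t *\<^sub>R v) (y - c) = t *\<^sub>R w' (\<gamma> y t) (y - c) v" for v
        using symm[OF \<gamma>[OF y], of t "t *\<^sub>R v" "y - c"] t by (simp add: blinfun.scaleR_right)
      have fx_eq: "blinfun_apply (fx y t) = (\<lambda>v. w (\<gamma> y t) v + w' (\<gamma> y t) (t *\<^sub>R v) (y - c))"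
        unfolding sy by (rule ext) (simp only: fx_def blinfun.add_left blinfun.scaleR_left add.commute)
      show "((\<lambda>x. w (\<gamma> x t) (x - c)) has_derivative blinfun_apply (fx y t)) (at y within U)"
        unfolding fx_eq by (rule hd)
    next
      fix y assume y: "y \<in> U"
      show "(\<lambda>t. w (\<gamma> y t) (y - c)) integrable_on cbox 0 1"
        using \<gamma>[OF y] unfolding \<gamma>_def
        by (intro integrable_continuous continuous_intros continuous_on_compose2[OF contw]) auto
    next
      have "continuous_on (U \<times> cbox 0 1) (\<lambda>z. w' (\<gamma> (fst z) (snd z)))"
        "continuous_on (U \<times> cbox 0 1) (\<lambda>z. w (\<gamma> (fst z) (snd z)))"
        using \<gamma> unfolding \<gamma>_def
        by (intro continuous_on_compose2[OF cont] continuous_on_compose2[OF contw] continuous_intros; force)+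
      then show "continuous_on (U \<times> cbox 0 1) (\<lambda>(y, t). fx y t)"
        unfolding fx_def case_prod_beta by (intro continuous_intros)
    qed (rule x, rule assms(1))
    moreover have "integral (cbox 0 1) (fx x) = w x"
    proof -
      have "((\<lambda>t. t *\<^sub>R w (\<gamma> x t)) has_vector_derivative fx x t) (at t within {0..1})"
        if t: "t \<in> {0..1}" for t
      proof -
        have "((\<lambda>t. w (\<gamma> x t)) has_derivative (\<lambda>s. w' (\<gamma> x t) (s *\<^sub>R (x - c)))) (at t within {0..1})"
          using \<gamma>[OF x t] unfolding \<gamma>_def
          by (intro has_derivative_compose[where g = w, OF _ deriv]) (auto intro!: derivative_eq_intros)
        then have "((\<lambda>t. w (\<gamma> x t)) has_vector_derivative w' (\<gamma> x t) (x - c)) (at t within {0..1})"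
          by (simp add: has_vector_derivative_def blinfun.scaleR_right)
        from has_vector_derivative_scaleR[OF DERIV_ident this] show ?thesis
          unfolding fx_def by simp
      qed
      then have "(fx x has_integral 1 *\<^sub>R w (\<gamma> x 1) - 0 *\<^sub>R w (\<gamma> x 0)) {0..1}"
        by (intro fundamental_theorem_of_calculus) auto
      then show ?thesis
        by (simp add: \<gamma>_def integral_unique)
    qed
    ultimately show ?thesis
      using at_within_open[OF x \<open>open U\<close>] by metis
  qed
  then show ?thesis by (intro exI[of _ h] ballI)
qed simp

text \<open>The Riemann map reduces a simply connected domain to the disc: closedness survives the pull-back
  along its inverse, and a primitive on the disc is transported back.\<close>

lemma closed_form_has_primitive_complex:
  fixes w :: "complex \<Rightarrow> complex \<Rightarrow>\<^sub>L 'b::banach"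
    and w' :: "complex \<Rightarrow> complex \<Rightarrow>\<^sub>L (complex \<Rightarrow>\<^sub>L 'b)"
  assumes S: "open S" "simply_connected S"
    and deriv: "\<And>x. x \<in> S \<Longrightarrow> (w has_derivative w' x) (at x)"
    and cont: "continuous_on S w'"
    and symm: "\<And>x u v. x \<in> S \<Longrightarrow> w' x u v = w' x v u"
  shows "\<exists>h. \<forall>x\<in>S. (h has_derivative w x) (at x)"
proof -
  \<comment> \<open>The empty set and the whole plane have no Riemann map onto the disc, but both
    are convex.\<close>
  consider "S = {} \<or> S = UNIV" | f g where "f holomorphic_on S" "g holomorphic_on ball 0 1"
     "\<And>z. z \<in> S \<Longrightarrow> f z \<in> ball 0 1 \<and> g (f z) = z" "\<And>z. z \<in> ball 0 1 \<Longrightarrow> g z \<in> S \<and> f (g z) = z"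
    using S Riemann_mapping_theorem[of S] by metis
  then show ?thesis
  proof cases
    case 1
    then have "convex S" by auto
    then show ?thesis
      using closed_form_has_primitive_convex[OF _ S(1) deriv cont symm] by blast
  next
    case (2 f g)
    let ?B = "ball 0 1 :: complex set"
    define g1 where "g1 = deriv g"
    define g2 where "g2 = deriv g1"
    have holg1: "g1 holomorphic_on ?B" and holg2: "g2 holomorphic_on ?B"
      unfolding g1_def g2_def by (intro holomorphic_deriv 2 open_ball)+
    have g1: "(g has_field_derivative g1 z) (at z)" if "z \<in> ?B" for z
      unfolding g1_def by (rule holomorphic_derivI[OF 2(2) open_ball that])
    have g2: "(g1 has_field_derivative g2 z) (at z)" if "z \<in> ?B" for z
      unfolding g2_def by (rule holomorphic_derivI[OF holg1 open_ball that])
    define m where "m = (blinfun_mult_right :: complex \<Rightarrow> complex \<Rightarrow>\<^sub>L complex)"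
    have bl_m: "bounded_linear m"
      unfolding m_def by (rule bounded_linear_blinfun_mult_right)
    \<comment> \<open>The pull-back of \<open>w\<close> along \<open>g\<close>: \<open>m a\<close>
      is multiplication by \<open>a\<close>, so \<open>\<eta> z v\<close> is
      \<open>w (g z) (g1 z * v)\<close>. Its derivative brings in the second derivative
      \<open>g2\<close> of \<open>g\<close>.\<close>
    define \<eta> where "\<eta> = (\<lambda>z. w (g z) o\<^sub>L m (g1 z))"
    define \<eta>D where "\<eta>D = (\<lambda>z v. (w' (g z) (g1 z * v) o\<^sub>L m (g1 z)) + (w (g z) o\<^sub>L m (g2 z * v)))"
    have \<eta>D: "(\<eta> has_derivative \<eta>D z) (at z)" if z: "z \<in> ?B" for z
    proof -
      have "((\<lambda>z. w (g z)) has_derivative (\<lambda>v. w' (g z) (g1 z * v))) (at z)"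
        using g1[OF z] 2(4)[OF z] unfolding has_field_derivative_def
        by (intro has_derivative_compose[where g = w, OF _ deriv]) auto
      moreover have "((\<lambda>z. m (g1 z)) has_derivative (\<lambda>v. m (g2 z * v))) (at z)"
        using g2[OF z] unfolding has_field_derivative_def
        by (rule bounded_linear.has_derivative[OF bl_m])
      ultimately show ?thesis
        unfolding \<eta>_def \<eta>D_def
        by (auto intro!: bounded_bilinear.FDERIV[OF bounded_bilinear_blinfun_compose, THEN has_derivative_eq_rhs] simp: add.commute)
    qed
    define \<eta>' where "\<eta>' = (\<lambda>z. Blinfun (\<eta>D z))"
    have ap: "blinfun_apply (\<eta>' z) = \<eta>D z" if "z \<in> ?B" for z
      unfolding \<eta>'_def by (rule bounded_linear_Blinfun_apply) (use \<eta>D[OF that] in \<open>rule has_derivative_bounded_linear\<close>)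
    have "\<exists>h. \<forall>z\<in>?B. (h has_derivative \<eta> z) (at z)"
    proof (rule closed_form_has_primitive_convex[of _ _ \<eta>'])
      show "(\<eta> has_derivative \<eta>' z) (at z)" if "z \<in> ?B" for z
        using \<eta>D[OF that] ap[OF that] by simp
      \<comment> \<open>One term is \<open>w' (g z)\<close> at \<open>g1 z * u\<close> and
        \<open>g1 z * v\<close>, symmetric by assumption; the other is \<open>w (g z)\<close> at
        \<open>g2 z * u * v\<close>, symmetric because complex multiplication commutes.\<close>
      show "\<eta>' z u v = \<eta>' z v u" if "z \<in> ?B" for z u v
        using symm[of "g z" "g1 z * u" "g1 z * v"] 2(4)[OF that]
        by (simp add: ap[OF that] \<eta>D_def blinfun.add_left m_def ac_simps)
      show "continuous_on ?B \<eta>'"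
      proof (rule continuous_on_blinfun_componentwise)
        fix v :: complex
        have cg: "continuous_on ?B g" "continuous_on ?B g1" "continuous_on ?B g2"
          using 2 holg1 holg2 by (auto intro: holomorphic_on_imp_continuous_on)
        have "continuous_on S w"
          by (meson deriv has_derivative_continuous continuous_at_imp_continuous_on)
        then have "continuous_on ?B (\<lambda>z. w (g z))" "continuous_on ?B (\<lambda>z. w' (g z))"
          using cont cg(1) 2(4) by (auto intro: continuous_on_compose2)
        moreover have "continuous_on ?B (\<lambda>z. m (g1 z))" "continuous_on ?B (\<lambda>z. m (g2 z * v))"
          by (intro bounded_linear.continuous_on[OF bl_m] continuous_intros cg)+
        ultimately have "continuous_on ?B (\<lambda>z. \<eta>D z v)"
          unfolding \<eta>D_def
          by (intro continuous_intros bounded_bilinear.continuous_on[OF bounded_bilinear_blinfun_compose] cg)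
        then show "continuous_on ?B (\<lambda>z. \<eta>' z v)"
          by (subst continuous_on_cong[OF refl, of _ _ "\<lambda>z. \<eta>D z v"]) (simp_all only: ap)
      qed
    qed auto
    then obtain h where h: "\<And>z. z \<in> ?B \<Longrightarrow> (h has_derivative \<eta> z) (at z)" by blast
    have "((\<lambda>z. h (f z)) has_derivative w z) (at z)" if z: "z \<in> S" for z
    proof -
      have df: "(f has_field_derivative deriv f z) (at z)"
        by (rule holomorphic_derivI[OF 2(1) S(1) z])
      have fz: "f z \<in> ?B" "g (f z) = z" using 2(3)[OF z] by auto
      \<comment> \<open>Near \<open>z\<close> the composite of \<open>g\<close> and \<open>f\<close>
        is the identity, so their derivatives are mutually inverse factors and pulling
        \<open>\<eta>\<close> back along \<open>f\<close> recovers \<open>w\<close>.\<close>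
      have "((\<lambda>z. g (f z)) has_field_derivative g1 (f z) * deriv f z) (at z)"
        using DERIV_chain2[OF g1[OF fz(1)] df] .
      moreover have "((\<lambda>z. g (f z)) has_field_derivative 1) (at z)"
        by (rule has_field_derivative_transform_within_open[OF DERIV_ident S(1) z]) (use 2(3) in auto)
      ultimately have 1: "g1 (f z) * deriv f z = 1"
        by (rule DERIV_unique)
      have "((\<lambda>z. h (f z)) has_derivative (\<lambda>v. \<eta> (f z) (deriv f z * v))) (at z)"
        using df h[OF fz(1)] unfolding has_field_derivative_def
        by (rule has_derivative_compose)
      moreover have "\<eta> (f z) (deriv f z * v) = w z v" for v
        by (simp add: \<eta>_def m_def fz(2) mult.assoc[symmetric] 1)
      ultimately show ?thesis by simp
    qed
    then show ?thesis by (rule_tac exI[of _ "\<lambda>z. h (f z)"]) blast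
  qed
qed

section \<open>Calculus of \<open>Ck_on\<close> functions on open plane sets\<close>

lemma Ck_on_cong:
  assumes "open \<Omega>" "\<And>x. x \<in> \<Omega> \<Longrightarrow> f x = g x"
  shows "Ck_on k \<Omega> f \<longleftrightarrow> Ck_on k \<Omega> g"
  using assms(2)
proof (induction k arbitrary: f g)
  case 0
  then show ?case by (simp cong: continuous_on_cong)
next
  case (Suc k)
  have hd: "(f has_derivative D) (at x) \<longleftrightarrow> (g has_derivative D) (at x)" if "x \<in> \<Omega>" for x D
    using that Suc.prems by (auto intro: has_derivative_transform_within_open[OF _ assms(1)])
  then have "f differentiable (at x) \<longleftrightarrow> g differentiable (at x)"
    "frechet_derivative f (at x) = frechet_derivative g (at x)" if "x \<in> \<Omega>" for x
    using that by (auto simp: differentiable_def frechet_derivative_def)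
  then show ?case
    using Suc.IH[of "\<lambda>x. frechet_derivative f (at x) v" "\<lambda>x. frechet_derivative g (at x) v" for v]
    by simp
qed

lemma Ck_on_SucD: "Ck_on (Suc k) \<Omega> f \<Longrightarrow> Ck_on k \<Omega> f"
proof (induction k arbitrary: f)
  case 0
  then show ?case
    by (auto intro!: continuous_at_imp_continuous_on differentiable_imp_continuous_within)
next
  case (Suc k)
  then show ?case by (metis Ck_on.simps(2))
qed

text \<open>Uniqueness of derivatives allows any explicit formula \<open>f'\<close> in place of
  \<open>frechet_derivative\<close>; the closure properties below are proved by supplying such a
  formula.\<close>

lemma Ck_on_SucI:
  assumes "open \<Omega>" "\<And>x. x \<in> \<Omega> \<Longrightarrow> (f has_derivative f' x) (at x)"
    and "\<And>v. Ck_on k \<Omega> (\<lambda>x. f' x v)"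
  shows "Ck_on (Suc k) \<Omega> f"
proof -
  have "frechet_derivative f (at x) = f' x" if "x \<in> \<Omega>" for x
    using assms(2)[OF that] frechet_derivative_at by metis
  then have "Ck_on k \<Omega> (\<lambda>x. frechet_derivative f (at x) v)" for v
    using assms(3)[of v] by (subst Ck_on_cong[OF assms(1), where g = "\<lambda>x. f' x v"]) auto
  then show ?thesis
    unfolding Ck_on.simps differentiable_def using assms(2) by blast
qed

lemma Ck_on_SucE:
  assumes "Ck_on (Suc k) \<Omega> f"
  obtains "\<And>x. x \<in> \<Omega> \<Longrightarrow> (f has_derivative frechet_derivative f (at x)) (at x)"
    "\<And>v. Ck_on k \<Omega> (\<lambda>x. frechet_derivative f (at x) v)"
  using assms by (auto simp: frechet_derivative_works)

lemma Ck_on_const: "open \<Omega> \<Longrightarrow> Ck_on k \<Omega> (\<lambda>x. c)"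
proof (induction k arbitrary: c)
  case (Suc k)
  then show ?case
    by (intro Ck_on_SucI[where f' = "\<lambda>_ _. 0"] has_derivative_const)
qed simp

lemma Ck_on_add:
  assumes "open \<Omega>" "Ck_on k \<Omega> f" "Ck_on k \<Omega> g"
  shows "Ck_on k \<Omega> (\<lambda>x. f x + g x)"
  using assms(2,3)
proof (induction k arbitrary: f g)
  case (Suc k)
  show ?case
  proof (rule Ck_on_SucE[OF Suc.prems(1)], rule Ck_on_SucE[OF Suc.prems(2)], rule Ck_on_SucI[OF assms(1)])
  qed (rule has_derivative_add Suc.IH; assumption)+
qed (simp add: continuous_on_add)

lemma Ck_on_mult:
  assumes "open \<Omega>" "Ck_on k \<Omega> f" "Ck_on k \<Omega> g"
  shows "Ck_on k \<Omega> (\<lambda>x. f x * g x)"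
  using assms(2,3)
proof (induction k arbitrary: f g)
  case (Suc k)
  \<comment> \<open>The product rule leaves undifferentiated factors behind, so the induction
    hypothesis must also apply to \<open>f\<close> and \<open>g\<close> themselves, one order
    lower.\<close>
  note fg = Suc.prems[THEN Ck_on_SucD]
  show ?case
  proof (rule Ck_on_SucE[OF Suc.prems(1)], rule Ck_on_SucE[OF Suc.prems(2)], rule Ck_on_SucI[OF assms(1)])
  qed (rule has_derivative_mult Ck_on_add assms Suc.IH fg; assumption?)+
qed (simp add: continuous_on_mult)

lemma Ck_on_inverse:
  assumes "open \<Omega>" "Ck_on k \<Omega> f" "\<And>x. x \<in> \<Omega> \<Longrightarrow> f x \<noteq> 0"
  shows "Ck_on k \<Omega> (\<lambda>x. inverse (f x))"
  using assms(2)
proof (induction k)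
  case 0
  then show ?case using assms(3) by (simp add: continuous_on_inverse)
next
  case (Suc k)
  \<comment> \<open>The derivative of \<open>inverse (f x)\<close> again contains
    \<open>inverse (f x)\<close>, which the induction hypothesis covers at the lower order.\<close>
  note IH = Suc.IH[OF Ck_on_SucD[OF Suc.prems]]
  show ?case
  proof (rule Ck_on_SucE[OF Suc.prems], rule Ck_on_SucI[OF assms(1)])
    fix x assume "x \<in> \<Omega>" and *: "\<And>x. x \<in> \<Omega> \<Longrightarrow> (f has_derivative frechet_derivative f (at x)) (at x)"
    show "((\<lambda>x. inverse (f x)) has_derivative
        (\<lambda>v. (- 1) * (inverse (f x) * (frechet_derivative f (at x) v * inverse (f x))))) (at x)"
      using Deriv.has_derivative_inverse[OF assms(3)[OF \<open>x \<in> \<Omega>\<close>] *[OF \<open>x \<in> \<Omega>\<close>]] by (simp add: mult.assoc)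
  qed (rule Ck_on_mult Ck_on_const assms IH; assumption?)+
qed

lemma Ck_on_sum:
  assumes "open \<Omega>" "\<And>i. i \<in> I \<Longrightarrow> Ck_on k \<Omega> (f i)"
  shows "Ck_on k \<Omega> (\<lambda>x. \<Sum>i\<in>I. f i x)"
  using assms(2)
  by (induction I rule: infinite_finite_induct) (auto intro: Ck_on_const Ck_on_add assms(1))

lemma Ck_on_prod:
  assumes "open \<Omega>" "\<And>i. i \<in> I \<Longrightarrow> Ck_on k \<Omega> (f i)"
  shows "Ck_on k \<Omega> (\<lambda>x. \<Prod>i\<in>I. f i x)"
  using assms(2)
  by (induction I rule: infinite_finite_induct) (auto intro: Ck_on_const Ck_on_mult assms(1))

text \<open>The form is P dx + Q dy. It is moved to the complex plane, where the Riemann map lives,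
  by the real-linear identifications \<open>r\<close> and \<open>c\<close>, and its primitive is
  moved back.\<close>

lemma closed_form_has_primitive_plane:
  assumes \<Omega>: "open \<Omega>" "simply_connected \<Omega>"
    and P: "Ck_on (Suc 0) \<Omega> P" and Q: "Ck_on (Suc 0) \<Omega> Q"
    and closed: "\<And>x. x \<in> \<Omega> \<Longrightarrow> frechet_derivative P (at x) (0, 1) = frechet_derivative Q (at x) (1, 0)"
  shows "\<exists>h. \<forall>x\<in>\<Omega>. (h has_derivative (\<lambda>v. fst v *\<^sub>R P x + snd v *\<^sub>R Q x)) (at x)"
proof -
  define r where "r = (\<lambda>z. (Re z, Im z))"
  define c where "c = (\<lambda>x. Complex (fst x) (snd x))"
  have c_eq: "c = (\<lambda>x. of_real (fst x) + \<i> * of_real (snd x))"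
    by (auto simp: c_def complex_eq_iff)
  have rc: "r (c x) = x" "c (r z) = z" for x z
    by (simp_all add: r_def c_def)
  have bl_r: "bounded_linear r"
    unfolding r_def by (intro bounded_linear_Pair bounded_linear_Re bounded_linear_Im)
  have bl_c: "bounded_linear c"
    unfolding c_eq
    by (intro bounded_linear_add bounded_linear_mult_right[THEN bounded_linear_compose]
          bounded_linear_of_real[THEN bounded_linear_compose] bounded_linear_fst bounded_linear_snd)
  have cont_r: "continuous_on A r" and cont_c: "continuous_on B c" for A B
    using bl_r bl_c by (auto intro: linear_continuous_on)
  define S where "S = r -` \<Omega>"
  have "open S"
    unfolding S_def using \<Omega>(1) cont_r by (rule open_vimage)
  have rS: "r z \<in> \<Omega>" if "z \<in> S" for z using that by (simp add: S_def)
  have "homeomorphism \<Omega> S c r"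
    by (rule homeomorphismI) (auto simp: cont_r cont_c S_def rc)
  then have "simply_connected S"
    using \<Omega>(2) homeomorphic_simply_connected_eq homeomorphic_def by blast
  let ?re = "Blinfun Re" and ?im = "Blinfun Im"
  have reim: "blinfun_apply ?re = Re" "blinfun_apply ?im = Im"
    by (simp_all add: bounded_linear_Blinfun_apply bounded_linear_Re bounded_linear_Im)
  \<comment> \<open>\<open>sc k a\<close> is the rank-one map sending \<open>v\<close> to
    \<open>k v *\<^sub>R a\<close>. With \<open>k\<close> the real or imaginary part it plays the
    role of a dx or a dy.\<close>
  define sc where "sc = (\<lambda>(k :: complex \<Rightarrow>\<^sub>L real) (a :: complex). blinfun_scaleR_left a o\<^sub>L k)"
  have sc: "sc k a v = k v *\<^sub>R a" for k a v
    by (simp add: sc_def)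
  have bl_sc: "bounded_linear (sc k)" for k
    unfolding sc_def
    by (intro bounded_linear_compose[OF bounded_bilinear.bounded_linear_left[OF bounded_bilinear_blinfun_compose]]
        bounded_linear_blinfun_scaleR_left)
  define w where "w = (\<lambda>z. sc ?re (P (r z)) + sc ?im (Q (r z)))"
  let ?DP = "\<lambda>z. frechet_derivative P (at (r z))"
  let ?DQ = "\<lambda>z. frechet_derivative Q (at (r z))"
  define wD where "wD = (\<lambda>z u. sc ?re (?DP z (r u)) + sc ?im (?DQ z (r u)))"
  have DP: "(P has_derivative ?DP z) (at (r z))" and DQ: "(Q has_derivative ?DQ z) (at (r z))"
    if "z \<in> S" for z
    using P Q rS[OF that] by (auto simp: frechet_derivative_works)
  have wD: "(w has_derivative wD z) (at z)" if z: "z \<in> S" for z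
    unfolding w_def wD_def
    by (intro has_derivative_add bounded_linear.has_derivative[OF bl_sc]
      has_derivative_compose[OF bounded_linear_imp_has_derivative[OF bl_r]] DP[OF z] DQ[OF z])
  define w' where "w' = (\<lambda>z. Blinfun (wD z))"
  have ap: "blinfun_apply (w' z) = wD z" if "z \<in> S" for z
    unfolding w'_def by (rule bounded_linear_Blinfun_apply) (use wD[OF that] in \<open>rule has_derivative_bounded_linear\<close>)
  have "\<exists>h. \<forall>z\<in>S. (h has_derivative w z) (at z)"
  proof (rule closed_form_has_primitive_complex[of _ _ w'])
    show "(w has_derivative w' z) (at z)" if "z \<in> S" for z
      using wD[OF that] ap[OF that] by simp
    show "w' z u v = w' z v u" if z: "z \<in> S" for z u v
    proof -
      \<comment> \<open>After expansion in the standard basis, the only terms not symmetric by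
        inspection are the mixed ones, with coefficients the y-derivative of \<open>P\<close> and
        the x-derivative of \<open>Q\<close>; \<open>closed\<close> equates these.\<close>
      have r: "r u = Re u *\<^sub>R (1, 0) + Im u *\<^sub>R (0, 1)" for u by (simp add: r_def)
      have "?DP z (r u) = Re u *\<^sub>R ?DP z (1, 0) + Im u *\<^sub>R ?DP z (0, 1)"
           "?DQ z (r u) = Re u *\<^sub>R ?DQ z (1, 0) + Im u *\<^sub>R ?DQ z (0, 1)" for u
        unfolding r[of u] using DP[OF z, THEN has_derivative_linear] DQ[OF z, THEN has_derivative_linear]
        by (simp_all only: linear_add linear_scale)
      then show ?thesis
        using closed[OF rS[OF z]]
        by (simp add: ap[OF z] wD_def blinfun.add_left sc reim algebra_simps)
    qed
    show "continuous_on S w'"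
    proof (rule continuous_on_blinfun_componentwise)
      fix v :: complex
      have "continuous_on \<Omega> (\<lambda>x. frechet_derivative P (at x) (r v))"
        "continuous_on \<Omega> (\<lambda>x. frechet_derivative Q (at x) (r v))"
        using P Q by (simp_all only: Ck_on.simps)
      from this[THEN continuous_on_compose2, OF cont_r]
      have "continuous_on S (\<lambda>z. ?DP z (r v))" "continuous_on S (\<lambda>z. ?DQ z (r v))"
        using rS by auto
      then have "continuous_on S (\<lambda>z. wD z v)"
        unfolding wD_def by (intro continuous_intros bounded_linear.continuous_on[OF bl_sc])
      then show "continuous_on S (\<lambda>z. w' z v)"
        by (rule continuous_on_eq) (simp add: ap)
    qed
  qed fact+
  then obtain h where h: "\<And>z. z \<in> S \<Longrightarrow> (h has_derivative w z) (at z)" by blast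
  have "((\<lambda>x. h (c x)) has_derivative (\<lambda>v. w (c x) (c v))) (at x)" if "x \<in> \<Omega>" for x
    using that by (intro has_derivative_compose[OF bounded_linear_imp_has_derivative[OF bl_c] h]) (simp add: S_def rc)
  moreover have "w (c x) (c v) = fst v *\<^sub>R P x + snd v *\<^sub>R Q x" for x v
    by (simp add: w_def blinfun.add_left sc reim rc) (simp add: c_def)
  ultimately show ?thesis
    by (intro exI[of _ "\<lambda>x. h (c x)"]) simp
qed

section \<open>The Grassmann algebra\<close>

lemma gcoeff_simps [simp]:
  fixes a b :: "'g::{finite,linorder} grassmann"
  shows "gcoeff (0 :: 'g grassmann) S = 0"
    "gcoeff (1 :: 'g grassmann) S = (if S = {} then 1 else 0)"
    "gcoeff (a + b) S = gcoeff a S + gcoeff b S"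
    "gcoeff (a - b) S = gcoeff a S - gcoeff b S"
    "gcoeff (- a) S = - gcoeff a S"
  by (simp_all add: zero_grassmann_def one_grassmann_def plus_grassmann_def minus_grassmann_def
      uminus_grassmann_def)

lemma gcoeff_gconst [simp]: "gcoeff (gconst z) S = (if S = {} then z else 0)"
  by (simp add: gconst_def)

lemma gcoeff_ggen [simp]: "gcoeff (ggen g) S = (if S = {g} then 1 else 0)"
  by (simp add: ggen_def)

lemma gcoeff_gderiv [simp]:
  "gcoeff (gderiv g a) S = (if g \<in> S then 0 else gsign {g} S * gcoeff a (insert g S))"
  by (simp add: gderiv_def)

lemma gcoeff_times:
  fixes a b :: "'g::{finite,linorder} grassmann"
  shows "gcoeff (a * b) S = (\<Sum>T\<in>Pow S. gsign T (S - T) * gcoeff a T * gcoeff b (S - T))"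
  by (simp add: times_grassmann_def)

lemma gcoeff_sum [simp]: "gcoeff (\<Sum>i\<in>I. f i :: 'g::{finite,linorder} grassmann) S = (\<Sum>i\<in>I. gcoeff (f i) S)"
  by (induction I rule: infinite_finite_induct) auto

lemma gcoeff_gconst_mult [simp]:
  fixes a :: "'g::{finite,linorder} grassmann"
  shows "gcoeff (gconst z * a) S = z * gcoeff a S"
proof -
  have "gcoeff (gconst z * a) S = (\<Sum>T\<in>Pow S. if T = {} then z * gcoeff a S else 0)"
    unfolding gcoeff_times by (rule sum.cong) auto
  then show ?thesis by simp
qed

lemma mult_gconst:
  fixes a :: "'g::{finite,linorder} grassmann"
  shows "a * gconst z = gconst z * a"
proof (rule grassmann_eqI)
  fix S
  have "gcoeff (a * gconst z) S = (\<Sum>T\<in>Pow S. if T = S then z * gcoeff a S else 0)"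
    unfolding gcoeff_times by (rule sum.cong) auto
  then show "gcoeff (a * gconst z) S = gcoeff (gconst z * a) S" by simp
qed

lemma mult_gconst_mult:
  fixes a b :: "'g::{finite,linorder} grassmann"
  shows "a * (gconst z * b) = gconst z * (a * b)"
  by (metis mult_gconst mult.assoc)

lemma gconst_mult [simp]:
  "gconst z * gconst w = (gconst (z * w) :: 'g::{finite,linorder} grassmann)"
  "gconst z * (gconst w * a) = gconst (z * w) * (a :: 'g grassmann)"
  by (auto intro: grassmann_eqI)

lemma gconst_1 [simp]: "gconst 1 = (1 :: 'g::{finite,linorder} grassmann)"
  by (auto intro: grassmann_eqI)

lemma gconst_minus_1: "gconst (- 1) = (- 1 :: 'g::{finite,linorder} grassmann)"
  by (auto intro: grassmann_eqI)

lemma gsign_square [simp]: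
  "gsign S T * gsign S T = 1" "gsign S T * (gsign S T * z) = z"
proof -
  show "gsign S T * gsign S T = 1"
    by (simp add: gsign_def flip: power_add mult_2)
  then show "gsign S T * (gsign S T * z) = z"
    by (simp add: mult.assoc[symmetric])
qed

text \<open>Every element of \<open>S\<close> lies on exactly one side of \<open>g\<close>, so the
  inversions counted by the two signs add up to \<open>card S\<close>.\<close>

lemma gsign_swap_singleton:
  fixes S :: "'g::{finite,linorder} set"
  assumes "g \<notin> S"
  shows "gsign S {g} = (-1) ^ card S * gsign {g} S"
proof -
  have "{(s, t). s \<in> {g} \<and> t \<in> S \<and> t < s} = Pair g ` {t \<in> S. t < g}"
    "{(s, t). s \<in> S \<and> t \<in> {g} \<and> t < s} = (\<lambda>s. (s, g)) ` {s \<in> S. g < s}"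
    by auto
  then have sg: "gsign {g} S = (-1) ^ card {t \<in> S. t < g}" "gsign S {g} = (-1) ^ card {t \<in> S. g < t}"
    by (simp_all add: gsign_def card_image inj_on_def)
  have "S = {t \<in> S. t < g} \<union> {t \<in> S. g < t}"
    using assms by auto (metis linorder_neqE)
  then have "card S = card {t \<in> S. t < g} + card {t \<in> S. g < t}"
    by (metis (no_types, lifting) card_Un_disjoint disjoint_iff finite mem_Collect_eq order.asym)
  then have "(-1) ^ card S = gsign {g} S * gsign S {g}"
    by (simp add: sg power_add)
  then show ?thesis by (simp add: ac_simps)
qed

lemma gcoeff_ggen_mult [simp]:
  fixes a :: "'g::{finite,linorder} grassmann"
  shows "gcoeff (ggen g * a) S = (if g \<in> S then gsign {g} (S - {g}) * gcoeff a (S - {g}) else 0)"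
proof -
  have "gcoeff (ggen g * a) S = (\<Sum>T\<in>Pow S. if T = {g} then gsign {g} (S - {g}) * gcoeff a (S - {g}) else 0)"
    unfolding gcoeff_times by (rule sum.cong) auto
  then show ?thesis by simp
qed

definition gbar :: "'g grassmann \<Rightarrow> 'g grassmann" where
  "gbar a = Grassmann (\<lambda>S. (-1) ^ card S * gcoeff a S)"

lemma gcoeff_gbar [simp]: "gcoeff (gbar a) S = (-1) ^ card S * gcoeff a S"
  by (simp add: gbar_def)

lemma gbar_gbar [simp]: "gbar (gbar a) = a"
  by (rule grassmann_eqI) (simp flip: mult.assoc power_add mult_2)

lemma gbar_simps [simp]:
  fixes a b :: "'g::{finite,linorder} grassmann"
  shows "gbar (0 :: 'g grassmann) = 0" "gbar (1 :: 'g grassmann) = 1"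
    "gbar (gconst z :: 'g grassmann) = gconst z" "gbar (ggen g :: 'g grassmann) = - ggen g"
    "gbar (a + b) = gbar a + gbar b" "gbar (a - b) = gbar a - gbar b" "gbar (- a) = - gbar a"
  by (auto intro!: grassmann_eqI simp: algebra_simps)

lemma gbar_mult [simp]:
  fixes a b :: "'g::{finite,linorder} grassmann"
  shows "gbar (a * b) = gbar a * gbar b"
proof (rule grassmann_eqI)
  fix S :: "'g set"
  have "card S = card T + card (S - T)" if "T \<in> Pow S" for T
    using that by (metis PowD card_mono card_Diff_subset finite le_add_diff_inverse)
  then show "gcoeff (gbar (a * b)) S = gcoeff (gbar a * gbar b) S"
    by (auto simp: gcoeff_times sum_distrib_left power_add intro!: sum.cong)
qed

lemma gbar_sum [simp]: "gbar (\<Sum>i\<in>I. f i :: 'g::{finite,linorder} grassmann) = (\<Sum>i\<in>I. gbar (f i))"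
  by (induction I rule: infinite_finite_induct) auto

lemma even_elem_iff_gbar:
  fixes a :: "'g::{finite,linorder} grassmann"
  shows "even_elem a \<longleftrightarrow> gbar a = a"
proof
  assume "gbar a = a"
  then have *: "(-1) ^ card S * gcoeff a S = gcoeff a S" for S
    by (metis gcoeff_gbar)
  show "even_elem a"
    unfolding even_elem_def
  proof (intro allI impI)
    fix S :: "'g set" assume "odd (card S)"
    then show "gcoeff a S = 0" using *[of S] by simp
  qed
qed (auto simp: even_elem_def minus_one_power_iff intro!: grassmann_eqI)

lemma odd_elem_iff_gbar:
  fixes a :: "'g::{finite,linorder} grassmann"
  shows "odd_elem a \<longleftrightarrow> gbar a = - a"
proof
  assume "gbar a = - a"
  then have *: "(-1) ^ card S * gcoeff a S = - gcoeff a S" for S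
    by (metis gcoeff_gbar gcoeff_simps(5))
  show "odd_elem a"
    unfolding odd_elem_def
  proof (intro allI impI)
    fix S :: "'g set" assume "even (card S)"
    then show "gcoeff a S = 0" using *[of S] by simp
  qed
qed (auto simp: odd_elem_def minus_one_power_iff intro!: grassmann_eqI)

text \<open>Moving \<open>g\<close> to the front of a monomial passes each of its generators once,
  which is the sign recorded by \<open>gbar\<close>. Monomials that already contain \<open>g\<close>
  contribute nothing on either side.\<close>

lemma mult_ggen:
  fixes a :: "'g::{finite,linorder} grassmann"
  shows "a * ggen g = ggen g * gbar a"
proof (rule grassmann_eqI)
  fix S
  have "gcoeff (a * ggen g) S =
      (\<Sum>T\<in>Pow S. if T = S - {g} then (if g \<in> S then gsign (S - {g}) {g} * gcoeff a (S - {g}) else 0) else 0)"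
    unfolding gcoeff_times
  proof (rule sum.cong)
    fix T assume "T \<in> Pow S"
    then have "S - T = {g} \<longleftrightarrow> T = S - {g} \<and> g \<in> S" by auto
    then show "gsign T (S - T) * gcoeff a T * gcoeff (ggen g) (S - T) =
      (if T = S - {g} then (if g \<in> S then gsign (S - {g}) {g} * gcoeff a (S - {g}) else 0) else 0)"
      by (auto simp: Diff_Diff_Int)
  qed simp
  then show "gcoeff (a * ggen g) S = gcoeff (ggen g * gbar a) S"
    by (simp add: gsign_swap_singleton[of g "S - {g}"])
qed

lemma mult_ggen_mult:
  fixes a b :: "'g::{finite,linorder} grassmann"
  shows "a * (ggen g * b) = ggen g * (gbar a * b)"
  by (metis mult_ggen mult.assoc)

lemma ggen_square [simp]: "ggen g * ggen g = (0 :: 'g::{finite,linorder} grassmann)"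
  by (auto intro!: grassmann_eqI)

lemma ggen_square_mult [simp]: "ggen g * (ggen g * a) = (0 :: 'g::{finite,linorder} grassmann)"
  by (simp flip: mult.assoc)

lemma ggen_anticommute:
  "ggen h * (ggen g * a) = - (ggen g * (ggen h * a) :: 'g::{finite,linorder} grassmann)"
  using mult_ggen_mult[of "ggen h" g a] by simp

lemma gderiv_simps [simp]:
  fixes a b :: "'g::{finite,linorder} grassmann"
  shows "gderiv g (0 :: 'g grassmann) = 0" "gderiv g (gconst z :: 'g grassmann) = 0"
    "gderiv g (a + b) = gderiv g a + gderiv g b"
    "gderiv g (a - b) = gderiv g a - gderiv g b" "gderiv g (- a) = - gderiv g a"
    "gderiv g (gconst z * a) = gconst z * gderiv g a"
  by (auto intro!: grassmann_eqI simp: algebra_simps)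

lemma gderiv_gderiv_same [simp]: "gderiv g (gderiv g a) = (0 :: 'g::{finite,linorder} grassmann)"
  by (auto intro!: grassmann_eqI)

text \<open>For distinct generators, \<open>gsign\<close> splits over disjoint unions, so the two
  orders of removal differ only in \<open>gsign {g} {h}\<close> against
  \<open>gsign {h} {g}\<close>, which are opposite. For equal generators both sides vanish.\<close>

lemma gderiv_anticommute:
  fixes a :: "'g::{finite,linorder} grassmann"
  shows "gderiv h (gderiv g a) = - gderiv g (gderiv h a)"
proof (cases "g = h")
  case False
  have *: "gsign {h} (insert g S) = gsign {h} {g} * gsign {h} S" if "g \<notin> S" for g h and S :: "'g set"
    using gsign_Un_right[of "{g}" S "{h}"] that by simp
  have **: "gsign {h} {g} = - gsign {g} {h}"
    using gsign_swap_singleton[of g "{h}"] False by simp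
  show ?thesis
  proof (rule grassmann_eqI)
    fix S :: "'g set"
    show "gcoeff (gderiv h (gderiv g a)) S = gcoeff (- gderiv g (gderiv h a)) S"
    proof (cases "g \<in> S \<or> h \<in> S")
      case False
      then show ?thesis
        using \<open>g \<noteq> h\<close> *[of g S h] *[of h S g] ** by (simp add: insert_commute)
    qed auto
  qed
qed simp

lemma gderiv_gbar [simp]:
  fixes a :: "'g::{finite,linorder} grassmann"
  shows "gderiv g (gbar a) = - gbar (gderiv g a)"
  by (rule grassmann_eqI) auto

lemma gderiv_ggen_mult_same:
  fixes a :: "'g::{finite,linorder} grassmann"
  shows "gderiv g (ggen g * a) = a - ggen g * gderiv g a"
proof (rule grassmann_eqI)
  fix S :: "'g set"
  show "gcoeff (gderiv g (ggen g * a)) S = gcoeff (a - ggen g * gderiv g a) S"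
    by (cases "g \<in> S") (simp_all add: insert_absorb)
qed

lemma gderiv_eq_0_iff:
  fixes a :: "'g::{finite,linorder} grassmann"
  shows "gderiv g a = 0 \<longleftrightarrow> (\<forall>S. g \<in> S \<longrightarrow> gcoeff a S = 0)"
proof
  assume 0: "gderiv g a = 0"
  show "\<forall>S. g \<in> S \<longrightarrow> gcoeff a S = 0"
  proof (intro allI impI)
    fix S assume g: "g \<in> S"
    have "gsign {g} (S - {g}) * gcoeff (gderiv g a) (S - {g}) = gcoeff a S"
      using g by (simp add: insert_absorb)
    then show "gcoeff a S = 0" by (simp add: 0)
  qed
qed (auto intro!: grassmann_eqI)

lemma gderiv_mult_eq_0:
  fixes a b :: "'g::{finite,linorder} grassmann"
  assumes "gderiv g a = 0" "gderiv g b = 0"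
  shows "gderiv g (a * b) = 0"
  unfolding gderiv_eq_0_iff gcoeff_times
proof (intro allI impI sum.neutral ballI)
  fix S T assume "g \<in> S" "T \<in> Pow S"
  then have "g \<in> T \<or> g \<in> S - T" by blast
  then have "gcoeff a T = 0 \<or> gcoeff b (S - T) = 0"
    using assms unfolding gderiv_eq_0_iff by blast
  then show "gsign T (S - T) * gcoeff a T * gcoeff b (S - T) = 0" by auto
qed

text \<open>Each factor is split into a part free of \<open>g\<close> and \<open>ggen g\<close>
  times another such part. The derivative of the product is then the coefficient of
  \<open>ggen g\<close>, and no signs have to be summed over subsets.\<close>

lemma gderiv_mult:
  fixes a b :: "'g::{finite,linorder} grassmann"
  shows "gderiv g (a * b) = gderiv g a * b + gbar a * gderiv g b"
proof -
  define a1 b1 where "a1 = gderiv g a" and "b1 = gderiv g b"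
  define a0 b0 where "a0 = a - ggen g * a1" and "b0 = b - ggen g * b1"
  have a: "a = a0 + ggen g * a1" and b: "b = b0 + ggen g * b1"
    by (simp_all add: a0_def b0_def)
  have free: "gderiv g a0 = 0" "gderiv g b0 = 0" "gderiv g a1 = 0" "gderiv g b1 = 0"
    by (simp_all add: a0_def b0_def a1_def b1_def gderiv_ggen_mult_same)
  have "a * b = a0 * b0 + ggen g * (a1 * b0 + gbar a0 * b1)"
    unfolding a b by (simp add: algebra_simps mult_ggen_mult[of a0] mult_ggen_mult[of a1])
  then have "gderiv g (a * b) = a1 * b0 + gbar a0 * b1"
    by (simp add: gderiv_ggen_mult_same gderiv_mult_eq_0 free)
  also have "\<dots> = a1 * b + gbar a * b1"
    unfolding a b by (simp add: algebra_simps mult_ggen_mult[of a0] mult_ggen_mult[of a1])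
  finally show ?thesis by (simp add: a1_def b1_def)
qed

lemma gderiv_ggen_mult_other:
  fixes a :: "'g::{finite,linorder} grassmann"
  assumes "g \<noteq> h"
  shows "gderiv g (ggen h * a) = - ggen h * gderiv g a"
proof -
  have "gderiv g (ggen h) = 0"
    using assms by (auto simp: gderiv_eq_0_iff)
  then show ?thesis by (simp add: gderiv_mult)
qed

text \<open>Complex linearity, with scalars embedded by \<open>gconst\<close>. It treats
  derivatives, the involution, fixed factors and projections uniformly: smoothness and
  \<open>pd_x\<close> pass through every such operator.\<close>

definition glinear :: "('g::{finite,linorder} grassmann \<Rightarrow> 'g grassmann) \<Rightarrow> bool" where
  "glinear L \<longleftrightarrow> (\<forall>a b. L (a + b) = L a + L b) \<and> (\<forall>z a. L (gconst z * a) = gconst z * L a)"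

lemma glinear_intros:
  "glinear (\<lambda>a. a)" "glinear (gderiv g)" "glinear gbar"
  "glinear L \<Longrightarrow> glinear (\<lambda>a. b * L a)" "glinear L \<Longrightarrow> glinear (\<lambda>a. L a * b)"
  "glinear L \<Longrightarrow> glinear (\<lambda>a. gderiv g (L a))" "glinear L \<Longrightarrow> glinear (\<lambda>a. gbar (L a))"
  "glinear L \<Longrightarrow> glinear M \<Longrightarrow> glinear (\<lambda>a. L a + M a)"
  "glinear L \<Longrightarrow> glinear M \<Longrightarrow> glinear (\<lambda>a. L a - M a)"
  "glinear L \<Longrightarrow> glinear (\<lambda>a. - L a)"
  by (auto simp: glinear_def algebra_simps mult_gconst_mult)

text \<open>\<open>Grassmann (\<lambda>R. if R = T then 1 else 0)\<close> is the basis monomial of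
  \<open>T\<close>. The algebra is finite-dimensional, so \<open>L\<close> is given by a constant
  matrix in this basis.\<close>

lemma gcoeff_glinear:
  fixes L :: "'g::{finite,linorder} grassmann \<Rightarrow> 'g grassmann"
  assumes "glinear L"
  shows "gcoeff (L a) S = (\<Sum>T\<in>UNIV. gcoeff (L (Grassmann (\<lambda>R. if R = T then 1 else 0))) S * gcoeff a T)"
proof -
  have L0: "L 0 = 0"
    using assms unfolding glinear_def by (metis add_cancel_left_left)
  have Lsum: "L (\<Sum>i\<in>I. f i) = (\<Sum>i\<in>I. L (f i))" for I and f :: "'g set \<Rightarrow> 'g grassmann"
    using assms L0 unfolding glinear_def by (induction I rule: infinite_finite_induct) auto
  have "a = (\<Sum>T\<in>UNIV. gconst (gcoeff a T) * Grassmann (\<lambda>R. if R = T then 1 else 0))"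
    by (rule grassmann_eqI) (simp add: if_distrib cong: if_cong)
  then have "gcoeff (L a) S =
      gcoeff (\<Sum>T\<in>UNIV. L (gconst (gcoeff a T) * Grassmann (\<lambda>R. if R = T then 1 else 0))) S"
    by (metis Lsum)
  then show ?thesis
    using assms unfolding glinear_def by (simp add: mult.commute)
qed

section \<open>Superfields\<close>

lemma smooth_on_cong:
  assumes "open \<Omega>" "\<And>x. x \<in> \<Omega> \<Longrightarrow> f x = g x"
  shows "smooth_on \<Omega> f \<longleftrightarrow> smooth_on \<Omega> g"
  using Ck_on_cong[OF assms(1), of "\<lambda>x. gcoeff (f x) S" "\<lambda>x. gcoeff (g x) S" for S] assms(2)
  by (simp add: smooth_on_def)

lemma smooth_on_const: "open \<Omega> \<Longrightarrow> smooth_on \<Omega> (\<lambda>x. c)"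
  by (simp add: smooth_on_def Ck_on_const)

lemma smooth_on_add:
  assumes "open \<Omega>" "smooth_on \<Omega> f" "smooth_on \<Omega> g"
  shows "smooth_on \<Omega> (\<lambda>x. f x + g x :: 'g::{finite,linorder} grassmann)"
  using assms by (simp add: smooth_on_def Ck_on_add)

lemma smooth_on_mult:
  assumes "open \<Omega>" "smooth_on \<Omega> f" "smooth_on \<Omega> g"
  shows "smooth_on \<Omega> (\<lambda>x. f x * g x :: 'g::{finite,linorder} grassmann)"
  using assms unfolding smooth_on_def gcoeff_times
  by (intro allI Ck_on_sum Ck_on_mult Ck_on_const) auto

lemma smooth_on_sum:
  assumes "open \<Omega>" "\<And>i. i \<in> I \<Longrightarrow> smooth_on \<Omega> (f i)"
  shows "smooth_on \<Omega> (\<lambda>x. \<Sum>i\<in>I. f i x :: 'g::{finite,linorder} grassmann)"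
  using assms(2)
  by (induction I rule: infinite_finite_induct) (simp_all add: smooth_on_const smooth_on_add assms(1))

lemma smooth_on_glinear:
  assumes "open \<Omega>" "smooth_on \<Omega> f" "glinear L"
  shows "smooth_on \<Omega> (\<lambda>x. L (f x))"
  unfolding smooth_on_def
proof (intro allI)
  fix S k
  have "Ck_on k \<Omega> (\<lambda>x. \<Sum>T\<in>UNIV. gcoeff (L (Grassmann (\<lambda>R. if R = T then 1 else 0))) S * gcoeff (f x) T)"
    using assms(1,2) by (intro Ck_on_sum Ck_on_mult Ck_on_const) (auto simp: smooth_on_def)
  then show "Ck_on k \<Omega> (\<lambda>x. gcoeff (L (f x)) S)"
    by (simp only: gcoeff_glinear[OF assms(3), of "f _"])
qed

definition sdifferentiable :: "'g sfield \<Rightarrow> point \<Rightarrow> bool" where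
  "sdifferentiable f x \<longleftrightarrow> (\<forall>S. (\<lambda>y. gcoeff (f y) S) differentiable (at x))"

lemma smooth_on_sdifferentiable: "smooth_on \<Omega> f \<Longrightarrow> x \<in> \<Omega> \<Longrightarrow> sdifferentiable f x"
  unfolding smooth_on_def sdifferentiable_def by (metis Ck_on.simps(2))

lemma gcoeff_pd_x: "gcoeff (pd_x j f x) S = frechet_derivative (\<lambda>y. gcoeff (f y) S) (at x) (dir j)"
  by (simp add: pd_x_def)

lemma pd_x_eqI:
  assumes "\<And>S. ((\<lambda>y. gcoeff (f y) S) has_derivative D S) (at x)"
  shows "pd_x j f x = Grassmann (\<lambda>S. D S (dir j))"
  unfolding pd_x_def using frechet_derivative_at[OF assms] by simp

lemma sdifferentiableD:
  assumes "sdifferentiable f x"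
  shows "((\<lambda>y. gcoeff (f y) S) has_derivative frechet_derivative (\<lambda>y. gcoeff (f y) S) (at x)) (at x)"
  using assms by (simp add: sdifferentiable_def frechet_derivative_works)

lemma pd_x_glinear:
  assumes "sdifferentiable f x" "glinear L"
  shows "pd_x j (\<lambda>y. L (f y)) x = L (pd_x j f x)"
proof -
  have "pd_x j (\<lambda>y. L (f y)) x = Grassmann (\<lambda>S. \<Sum>T\<in>UNIV.
      gcoeff (L (Grassmann (\<lambda>R. if R = T then 1 else 0))) S *
      frechet_derivative (\<lambda>y. gcoeff (f y) T) (at x) (dir j))"
    by (rule pd_x_eqI, subst gcoeff_glinear[OF assms(2)])
      (intro has_derivative_sum has_derivative_mult_right sdifferentiableD assms(1))
  then show ?thesis
    by (simp only: gcoeff_pd_x[symmetric] gcoeff_glinear[OF assms(2), symmetric] gcoeff_inverse)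
qed

lemma pd_x_add:
  assumes "sdifferentiable f x" "sdifferentiable g x"
  shows "pd_x j (\<lambda>y. f y + g y :: 'g::{finite,linorder} grassmann) x = pd_x j f x + pd_x j g x"
proof -
  have "pd_x j (\<lambda>y. f y + g y) x = Grassmann (\<lambda>S.
      frechet_derivative (\<lambda>y. gcoeff (f y) S) (at x) (dir j) +
      frechet_derivative (\<lambda>y. gcoeff (g y) S) (at x) (dir j))"
    by (rule pd_x_eqI, unfold gcoeff_simps) (intro has_derivative_add sdifferentiableD assms)
  then show ?thesis
    by (intro grassmann_eqI) (simp add: pd_x_def)
qed

lemma pd_x_mult:
  assumes "sdifferentiable f x" "sdifferentiable g x"
  shows "pd_x j (\<lambda>y. f y * g y :: 'g::{finite,linorder} grassmann) x = pd_x j f x * g x + f x * pd_x j g x"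
proof -
  have "pd_x j (\<lambda>y. f y * g y) x = Grassmann (\<lambda>S. \<Sum>T\<in>Pow S. gsign T (S - T) *
      (gcoeff (f x) T * frechet_derivative (\<lambda>y. gcoeff (g y) (S - T)) (at x) (dir j) +
       frechet_derivative (\<lambda>y. gcoeff (f y) T) (at x) (dir j) * gcoeff (g x) (S - T)))"
    by (rule pd_x_eqI) (unfold gcoeff_times mult.assoc, intro has_derivative_sum has_derivative_mult_right
        has_derivative_mult sdifferentiableD assms)
  then show ?thesis
    by (intro grassmann_eqI) (simp add: gcoeff_times pd_x_def algebra_simps sum.distrib)
qed

lemma pd_x_cong:
  assumes "open \<Omega>" "x \<in> \<Omega>" "\<And>y. y \<in> \<Omega> \<Longrightarrow> f y = g y"
  shows "pd_x j f x = pd_x j g x"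
proof -
  have "((\<lambda>y. gcoeff (f y) S) has_derivative D) (at x) \<longleftrightarrow>
      ((\<lambda>y. gcoeff (g y) S) has_derivative D) (at x)" for S D
    using assms by (auto intro: has_derivative_transform_within_open[OF _ assms(1,2)])
  then show ?thesis
    unfolding pd_x_def frechet_derivative_def by simp
qed

lemma covD_eq: "covD th j f x = gderiv (th j) (f x) - gconst \<i> * (ggen (th j) * pd_x j f x)"
  by (simp add: covD_def pd_theta_def mult.assoc)

lemma covD_cong:
  assumes "open \<Omega>" "x \<in> \<Omega>" "\<And>y. y \<in> \<Omega> \<Longrightarrow> f y = g y"
  shows "covD th j f x = covD th j g x"
  using pd_x_cong[OF assms] assms by (simp add: covD_eq)

lemma covD_add:
  assumes "sdifferentiable f x" "sdifferentiable g x"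
  shows "covD th j (\<lambda>y. f y + g y) x = covD th j f x + covD th j g x"
  by (simp add: covD_eq pd_x_add[OF assms] algebra_simps)

lemma covD_const: "covD th j (\<lambda>y. 0) x = 0"
  by (simp add: covD_eq pd_x_def zero_grassmann_def[symmetric])

lemma covD_gconst_mult:
  assumes "sdifferentiable f x"
  shows "covD th j (\<lambda>y. gconst z * f y) x = gconst z * covD th j f x"
  by (simp add: covD_eq pd_x_glinear[OF assms, where L = "\<lambda>a. gconst z * a"] glinear_intros
      right_diff_distrib mult_gconst_mult[of "ggen _"] mult.commute)

text \<open>In the second term of \<open>covD\<close> the generator \<open>ggen (th j)\<close> has
  to be moved past \<open>f x\<close>. This costs the same \<open>gbar\<close> as the Leibniz rule
  of the odd derivative, so one formula covers both terms.\<close>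

lemma covD_mult:
  assumes "sdifferentiable f x" "sdifferentiable g x"
  shows "covD th j (\<lambda>y. f y * g y) x = covD th j f x * g x + gbar (f x) * covD th j g x"
  by (simp add: covD_eq pd_x_mult[OF assms] gderiv_mult algebra_simps mult_gconst_mult[of "gbar (f x)"] mult_ggen_mult[of "gbar (f x)"])

text \<open>The sign expresses that \<open>covD\<close> reverses parity.\<close>

lemma covD_gbar:
  assumes "sdifferentiable f x"
  shows "covD th j (\<lambda>y. gbar (f y)) x = - gbar (covD th j f x)"
  by (simp add: covD_eq pd_x_glinear[OF assms, where L = gbar] glinear_intros algebra_simps)

section \<open>Potentials for the pair D_1, D_2\<close>

text \<open>\<open>gproj g h a\<close> is the part of \<open>a\<close> containing neither of the generators \<open>g\<close> and \<open>h\<close>.\<close>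

definition gproj :: "'g \<Rightarrow> 'g \<Rightarrow> 'g::{finite,linorder} grassmann \<Rightarrow> 'g grassmann" where
  "gproj g h a = (a - ggen g * gderiv g a) - ggen h * gderiv h (a - ggen g * gderiv g a)"

lemma glinear_gproj: "glinear L \<Longrightarrow> glinear (\<lambda>a. gproj g h (L a))"
  unfolding gproj_def by (intro glinear_intros)

lemma gproj_linear:
  "gproj g h (a + b) = gproj g h a + gproj g h b" "gproj g h (a - b) = gproj g h a - gproj g h b"
  "gproj g h (- a) = - gproj g h a" "gproj g h (gconst z * a) = gconst z * gproj g h a" "gproj g h 0 = 0"
  by (simp_all add: gproj_def algebra_simps mult_gconst_mult[of "ggen _"])

text \<open>The last equation is the expansion of an element in two odd generators. The others let
  the simplifier extract single components: differentiate by the chosen generators, then apply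
  \<open>gproj\<close>.\<close>

lemma gproj_rules:
  fixes g h :: "'g::{finite,linorder}" and a :: "'g grassmann"
  assumes "g \<noteq> h"
  shows "gderiv g (gproj g h a) = 0" "gderiv h (gproj g h a) = 0"
    "gproj g h (ggen g * a) = 0" "gproj g h (ggen h * a) = 0" "gproj g h (gproj g h a) = gproj g h a"
    "a = gproj g h a + ggen g * gproj g h (gderiv g a) + ggen h * gproj g h (gderiv h a)
       + ggen g * (ggen h * gproj g h (gderiv h (gderiv g a)))"
proof -
  note rules = gderiv_ggen_mult_same gderiv_ggen_mult_other[OF assms] gderiv_ggen_mult_other[OF assms[symmetric]]
    gderiv_anticommute[of h g] ggen_anticommute[of h g]
  show "gderiv g (gproj g h a) = 0" "gderiv h (gproj g h a) = 0"
    "gproj g h (ggen g * a) = 0" "gproj g h (ggen h * a) = 0" "gproj g h (gproj g h a) = gproj g h a"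
    by (simp_all add: gproj_def rules algebra_simps)
  show "a = gproj g h a + ggen g * gproj g h (gderiv g a) + ggen h * gproj g h (gderiv h a)
       + ggen g * (ggen h * gproj g h (gderiv h (gderiv g a)))"
    by (simp add: gproj_def rules algebra_simps)
qed

lemma smooth_on_primitive:
  fixes P Q :: "'g::{finite,linorder} sfield"
  assumes \<Omega>: "open \<Omega>" "simply_connected \<Omega>"
    and P: "smooth_on \<Omega> P" and Q: "smooth_on \<Omega> Q"
    and closed: "\<And>x. x \<in> \<Omega> \<Longrightarrow> pd_x 2 P x = pd_x 1 Q x"
  shows "\<exists>f. smooth_on \<Omega> f \<and> (\<forall>x\<in>\<Omega>. pd_x 1 f x = P x \<and> pd_x 2 f x = Q x)"
proof -
  have "\<exists>h. \<forall>x\<in>\<Omega>. (h has_derivative (\<lambda>v. fst v *\<^sub>R gcoeff (P x) S + snd v *\<^sub>R gcoeff (Q x) S)) (at x)" for S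
  proof (rule closed_form_has_primitive_plane[OF \<Omega>])
    show "Ck_on (Suc 0) \<Omega> (\<lambda>x. gcoeff (P x) S)" "Ck_on (Suc 0) \<Omega> (\<lambda>x. gcoeff (Q x) S)"
      using P Q by (simp_all only: smooth_on_def)
    fix x assume "x \<in> \<Omega>"
    from arg_cong[OF closed[OF this], of "\<lambda>a. gcoeff a S"]
    show "frechet_derivative (\<lambda>x. gcoeff (P x) S) (at x) (0, 1) =
        frechet_derivative (\<lambda>x. gcoeff (Q x) S) (at x) (1, 0)"
      by (simp add: gcoeff_pd_x dir_def)
  qed
  then obtain h where h: "\<And>S x. x \<in> \<Omega> \<Longrightarrow>
      (h S has_derivative (\<lambda>v. fst v *\<^sub>R gcoeff (P x) S + snd v *\<^sub>R gcoeff (Q x) S)) (at x)"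
    by metis
  define f where "f = (\<lambda>x. Grassmann (\<lambda>S. h S x))"
  \<comment> \<open>The partial derivatives of \<open>h S\<close> are coefficients of
    \<open>P\<close> and \<open>Q\<close>, so \<open>h S\<close> is one order smoother than they
    are.\<close>
  have "Ck_on (Suc k) \<Omega> (h S)" for S k
    by (rule Ck_on_SucI[OF \<Omega>(1) h])
      (use P Q in \<open>auto simp: scaleR_conv_of_real smooth_on_def intro!: Ck_on_add Ck_on_mult Ck_on_const \<Omega>(1)\<close>)
  then have "smooth_on \<Omega> f"
    unfolding smooth_on_def f_def gcoeff_Grassmann using Ck_on_SucD by blast
  moreover have "pd_x j f x = Grassmann (\<lambda>S. fst (dir j) *\<^sub>R gcoeff (P x) S + snd (dir j) *\<^sub>R gcoeff (Q x) S)"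
    if "x \<in> \<Omega>" for j x
    using h[OF that] by (intro pd_x_eqI) (simp add: f_def)
  ultimately show ?thesis
    by (intro exI[of _ f]) (simp add: dir_def gcoeff_inverse)
qed

text \<open>In components, with \<open>[b] = gproj (th 1) (th 2) b\<close>: the part \<open>a\<close> of \<open>f\<close> free of \<open>\<theta>\<^sup>1, \<theta>\<^sup>2\<close> has to solve
  \<open>\<partial>\<^bsub>x\<^sub>j\<^esub> a = \<i> [\<partial>\<^bsub>\<theta>\<^sup>j\<^esub> B\<^sub>j]\<close>, which the \<open>\<theta>\<^sup>1\<theta>\<^sup>2\<close> component of the hypothesis makes a closed form, while the
  other components of \<open>f\<close> are algebraic in \<open>B\<^sub>1, B\<^sub>2\<close>.\<close>

lemma covD_potential:
  fixes B1 B2 :: "'g::{finite,linorder} sfield"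
  assumes theta: "th 1 \<noteq> th 2" and \<Omega>: "open \<Omega>" "simply_connected \<Omega>"
    and B: "smooth_on \<Omega> B1" "smooth_on \<Omega> B2"
    and compat: "\<And>x. x \<in> \<Omega> \<Longrightarrow> covD th 1 B2 x + covD th 2 B1 x = 0"
  shows "\<exists>f. smooth_on \<Omega> f \<and> (\<forall>x\<in>\<Omega>. covD th 1 f x = B1 x \<and> covD th 2 f x = B2 x)"
proof -
  note [simp del] = One_nat_def
  let ?t1 = "ggen (th 1)" and ?t2 = "ggen (th 2)"
  let ?d1 = "gderiv (th 1)" and ?d2 = "gderiv (th 2)"
  let ?p = "gproj (th 1) (th 2)"
  note pr = gproj_rules[OF theta]
  note rules = gderiv_ggen_mult_same gderiv_ggen_mult_other[OF theta] gderiv_ggen_mult_other[OF theta[symmetric]]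
    gderiv_anticommute[of "th 2" "th 1"] ggen_anticommute[of "th 2" "th 1"] gproj_linear pr(1-5)
    mult_gconst_mult[of "ggen _"]
  note sd = B[THEN smooth_on_sdifferentiable]
  \<comment> \<open>The four components of \<open>compat\<close>, in the order: top component, theta
    1, theta 2, theta-free. The first is closedness of the 1-form; the others relate components of
    \<open>B1\<close> and \<open>B2\<close>.\<close>
  have comps: "?p (?d2 (pd_x 1 B2 x)) = ?p (?d1 (pd_x 2 B1 x))"
    "?p (?d1 (?d2 (B1 x))) = gconst \<i> * ?p (pd_x 1 B2 x)"
    "?p (?d1 (?d2 (B2 x))) = - gconst \<i> * ?p (pd_x 2 B1 x)"
    "?p (?d2 (B1 x)) = - ?p (?d1 (B2 x))" if "x \<in> \<Omega>" for x
  proof -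
    have H: "?d1 (B2 x) - gconst \<i> * (?t1 * pd_x 1 B2 x) + (?d2 (B1 x) - gconst \<i> * (?t2 * pd_x 2 B1 x)) = 0"
      using compat[OF that] by (simp add: covD_eq)
    have "gconst \<i> * (?p (?d2 (pd_x 1 B2 x)) - ?p (?d1 (pd_x 2 B1 x))) = 0"
      using arg_cong[OF H, of "\<lambda>a. ?p (?d1 (?d2 a))"] by (simp add: rules algebra_simps)
    \<comment> \<open>Multiplication by the inverse of the imaginary unit removes the scalar
      factor.\<close>
    then have "gconst (- \<i>) * (gconst \<i> * (?p (?d2 (pd_x 1 B2 x)) - ?p (?d1 (pd_x 2 B1 x)))) = 0"
      by (simp only: mult_zero_right)
    then show "?p (?d2 (pd_x 1 B2 x)) = ?p (?d1 (pd_x 2 B1 x))"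
      by simp
    show "?p (?d1 (?d2 (B1 x))) = gconst \<i> * ?p (pd_x 1 B2 x)"
      using arg_cong[OF H, of "\<lambda>a. ?p (?d1 a)"] by (simp add: rules algebra_simps)
    show "?p (?d1 (?d2 (B2 x))) = - gconst \<i> * ?p (pd_x 2 B1 x)"
      using arg_cong[OF H, of "\<lambda>a. ?p (?d2 a)"] by (simp add: rules algebra_simps add_eq_0_iff)
    show "?p (?d2 (B1 x)) = - ?p (?d1 (B2 x))"
      using arg_cong[OF H, of ?p] by (simp add: rules algebra_simps add_eq_0_iff)
  qed
  have lin: "glinear (\<lambda>a. gconst \<i> * ?p (?d1 a))" "glinear (\<lambda>a. gconst \<i> * ?p (?d2 a))"
    by (intro glinear_intros glinear_gproj)+
  have "\<exists>a. smooth_on \<Omega> a \<and> (\<forall>x\<in>\<Omega>. pd_x 1 a x = gconst \<i> * ?p (?d1 (B1 x)) \<and>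
      pd_x 2 a x = gconst \<i> * ?p (?d2 (B2 x)))"
  proof (rule smooth_on_primitive[OF \<Omega>])
    show "smooth_on \<Omega> (\<lambda>x. gconst \<i> * ?p (?d1 (B1 x)))" "smooth_on \<Omega> (\<lambda>x. gconst \<i> * ?p (?d2 (B2 x)))"
      using smooth_on_glinear[OF \<Omega>(1) B(1) lin(1)] smooth_on_glinear[OF \<Omega>(1) B(2) lin(2)] .
    show "pd_x 2 (\<lambda>x. gconst \<i> * ?p (?d1 (B1 x))) x = pd_x 1 (\<lambda>x. gconst \<i> * ?p (?d2 (B2 x))) x"
      if "x \<in> \<Omega>" for x
      using pd_x_glinear[OF sd(1)[OF that] lin(1)] pd_x_glinear[OF sd(2)[OF that] lin(2)] comps(1)[OF that]
      by simp
  qed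
  then obtain a where a: "smooth_on \<Omega> a"
    "\<And>x. x \<in> \<Omega> \<Longrightarrow> pd_x 1 a x = gconst \<i> * ?p (?d1 (B1 x))"
    "\<And>x. x \<in> \<Omega> \<Longrightarrow> pd_x 2 a x = gconst \<i> * ?p (?d2 (B2 x))"
    by blast
  have lin': "glinear ?p" "glinear (\<lambda>a. ?t1 * ?p a + ?t1 * (?t2 * ?p (?d2 a)))" "glinear (\<lambda>a. ?t2 * ?p a)"
    by (intro glinear_intros glinear_gproj)+
  \<comment> \<open>The equation for \<open>B1\<close> prescribes the theta 1 component and the top
    component, that for \<open>B2\<close> the theta 2 component. The primitive \<open>a\<close> may
    itself contain thetas; \<open>?p\<close> removes them and leaves its derivatives intact, since
    these are already projected.\<close>
  define f where "f = (\<lambda>x. ?p (a x) + ((?t1 * ?p (B1 x) + ?t1 * (?t2 * ?p (?d2 (B1 x)))) + ?t2 * ?p (B2 x)))"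
  note sm = smooth_on_glinear[OF \<Omega>(1) a(1) lin'(1)] smooth_on_glinear[OF \<Omega>(1) B(1) lin'(2)]
    smooth_on_glinear[OF \<Omega>(1) B(2) lin'(3)]
  have sm23: "smooth_on \<Omega> (\<lambda>x. (?t1 * ?p (B1 x) + ?t1 * (?t2 * ?p (?d2 (B1 x)))) + ?t2 * ?p (B2 x))"
    by (rule smooth_on_add[OF \<Omega>(1) sm(2,3)])
  have "smooth_on \<Omega> f"
    unfolding f_def by (rule smooth_on_add[OF \<Omega>(1) sm(1) sm23])
  moreover have "covD th 1 f x = B1 x \<and> covD th 2 f x = B2 x" if x: "x \<in> \<Omega>" for x
  proof -
    have X: "pd_x j f x = ?p (pd_x j a x) + ((?t1 * ?p (pd_x j B1 x) + ?t1 * (?t2 * ?p (?d2 (pd_x j B1 x))))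
        + ?t2 * ?p (pd_x j B2 x))" for j
      unfolding f_def pd_x_add[OF smooth_on_sdifferentiable[OF sm(1) x] smooth_on_sdifferentiable[OF sm23 x]]
        pd_x_add[OF smooth_on_sdifferentiable[OF sm(2) x] smooth_on_sdifferentiable[OF sm(3) x]]
        pd_x_glinear[OF smooth_on_sdifferentiable[OF a(1) x] lin'(1)]
        pd_x_glinear[OF sd(1)[OF x] lin'(2)] pd_x_glinear[OF sd(2)[OF x] lin'(3)] ..
    have "covD th 1 f x = ?p (B1 x) + ?t1 * ?p (?d1 (B1 x)) + ?t2 * ?p (?d2 (B1 x))
       + ?t1 * (?t2 * ?p (?d2 (?d1 (B1 x))))"
      unfolding covD_eq X a(2)[OF x]
      by (simp add: f_def rules algebra_simps gconst_minus_1 comps(2)[OF x])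
    \<comment> \<open>The top component of \<open>f\<close> was read off from \<open>B1\<close>;
      \<open>comps(4)\<close> makes it agree with what \<open>B2\<close> demands, and
      \<open>comps(3)\<close> settles the top component of this equation.\<close>
    moreover have "covD th 2 f x = ?p (B2 x) + ?t1 * ?p (?d1 (B2 x)) + ?t2 * ?p (?d2 (B2 x))
       + ?t1 * (?t2 * ?p (?d2 (?d1 (B2 x))))"
      unfolding covD_eq X a(3)[OF x]
      by (simp add: f_def rules algebra_simps gconst_minus_1 comps(3,4)[OF x])
    ultimately show ?thesis
      using pr(6) by metis
  qed
  ultimately show ?thesis by blast
qed

text \<open>\<open>s\<close> is the prescribed parity of \<open>f\<close>; the data have the
  opposite one, whence the minus sign in \<open>parity\<close>. As \<open>covD\<close> anticommutes
  with \<open>gbar\<close>, averaging \<open>f\<close> with \<open>gconst s * gbar (f x)\<close>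
  preserves both equations.\<close>

lemma covD_potential_parity:
  fixes B1 B2 :: "'g::{finite,linorder} sfield"
  assumes "th 1 \<noteq> th 2" and \<Omega>: "open \<Omega>" "simply_connected \<Omega>"
    and "smooth_on \<Omega> B1" "smooth_on \<Omega> B2"
    and "\<And>x. x \<in> \<Omega> \<Longrightarrow> covD th 1 B2 x + covD th 2 B1 x = 0"
    and s: "s * s = 1"
    and parity: "\<And>x. x \<in> \<Omega> \<Longrightarrow> gbar (B1 x) = - gconst s * B1 x" "\<And>x. x \<in> \<Omega> \<Longrightarrow> gbar (B2 x) = - gconst s * B2 x"
  shows "\<exists>f. smooth_on \<Omega> f \<and> (\<forall>x\<in>\<Omega>. covD th 1 f x = B1 x \<and> covD th 2 f x = B2 x) \<and>
    (\<forall>x. gbar (f x) = gconst s * f x)"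
proof -
  note [simp del] = One_nat_def
  obtain f where f: "smooth_on \<Omega> f"
    "\<And>x. x \<in> \<Omega> \<Longrightarrow> covD th 1 f x = B1 x" "\<And>x. x \<in> \<Omega> \<Longrightarrow> covD th 2 f x = B2 x"
    using covD_potential[of th \<Omega> B1 B2] assms by metis
  \<comment> \<open>the even (\<open>s = 1\<close>) or odd (\<open>s = -1\<close>) part of \<open>f\<close>\<close>
  define f' where "f' = (\<lambda>x. gconst (1/2) * f x + gconst (s/2) * gbar (f x))"
  have sm: "smooth_on \<Omega> (\<lambda>x. gconst (1/2) * f x)" "smooth_on \<Omega> (\<lambda>x. gconst (s/2) * gbar (f x))"
    by (intro smooth_on_glinear[OF \<Omega>(1) f(1)] glinear_intros)+
  have smb: "smooth_on \<Omega> (\<lambda>x. gbar (f x))"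
    by (intro smooth_on_glinear[OF \<Omega>(1) f(1)] glinear_intros)
  have covD': "covD th j f' x = gconst (1/2) * covD th j f x - gconst (s/2) * gbar (covD th j f x)"
    if x: "x \<in> \<Omega>" for j x
    unfolding f'_def
      covD_add[OF smooth_on_sdifferentiable[OF sm(1) x] smooth_on_sdifferentiable[OF sm(2) x]]
      covD_gconst_mult[OF smooth_on_sdifferentiable[OF f(1) x]]
      covD_gconst_mult[OF smooth_on_sdifferentiable[OF smb x]]
      covD_gbar[OF smooth_on_sdifferentiable[OF f(1) x]]
    by simp
  have half: "gconst (1/2) * b + gconst (1/2) * b = b" for b :: "'g grassmann"
    by (rule grassmann_eqI) simp
  have "smooth_on \<Omega> f'"
    unfolding f'_def by (rule smooth_on_add[OF \<Omega>(1) sm])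
  moreover have "covD th 1 f' x = B1 x" "covD th 2 f' x = B2 x" if x: "x \<in> \<Omega>" for x
    using half by (simp_all add: covD'[OF x] f x parity s)
  moreover have "gbar (f' x) = gconst s * f' x" for x
    by (simp add: f'_def algebra_simps s)
  ultimately show ?thesis by blast
qed

section \<open>Supermatrices\<close>

lemma index_mult_mat_sum:
  assumes "A \<in> carrier_mat n n" "B \<in> carrier_mat n n" "i < n" "j < n"
  shows "(A * B) $$ (i, j) = (\<Sum>k<n. A $$ (i, k) * B $$ (k, j))"
  using assms by (simp add: scalar_prod_def lessThan_atLeast0)

section \<open>Smoothness of inverse matrices\<close>

lemma Ck_on_det:
  fixes P :: "point \<Rightarrow> complex mat"
  assumes "open \<Omega>" "\<And>x. P x \<in> carrier_mat n n"
    and "\<And>i j. i < n \<Longrightarrow> j < n \<Longrightarrow> Ck_on k \<Omega> (\<lambda>x. P x $$ (i, j))"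
  shows "Ck_on k \<Omega> (\<lambda>x. Determinant.det (P x))"
  unfolding det_def'[OF assms(2)] using assms(1,3)
  by (intro Ck_on_sum Ck_on_mult Ck_on_prod Ck_on_const) (auto dest: permutes_in_image)

text \<open>Cramer's rule over the complex numbers: the entries of \<open>Q x\<close> are cofactors
  of \<open>P x\<close> divided by a determinant that cannot vanish, because \<open>P x\<close> has
  a right inverse.\<close>

lemma Ck_on_inverse_mat:
  fixes P Q :: "point \<Rightarrow> complex mat"
  assumes "open \<Omega>" and P: "\<And>x. P x \<in> carrier_mat n n" and Q: "\<And>x. x \<in> \<Omega> \<Longrightarrow> Q x \<in> carrier_mat n n"
    and PQ: "\<And>x. x \<in> \<Omega> \<Longrightarrow> P x * Q x = 1\<^sub>m n"
    and Ck: "\<And>i j. i < n \<Longrightarrow> j < n \<Longrightarrow> Ck_on k \<Omega> (\<lambda>x. P x $$ (i, j))"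
    and ij: "i < n" "j < n"
  shows "Ck_on k \<Omega> (\<lambda>x. Q x $$ (i, j))"
proof -
  have det: "Determinant.det (P x) \<noteq> 0" if "x \<in> \<Omega>" for x
    using det_mult[OF P Q[OF that], of x] PQ[OF that] by auto
  have "Q x $$ (i, j) = inverse (Determinant.det (P x)) * ((-1) ^ (j + i) * Determinant.det (mat_delete (P x) j i))"
    if x: "x \<in> \<Omega>" for x
  proof -
    have "adj_mat (P x) = adj_mat (P x) * (P x * Q x)"
      by (simp only: PQ[OF x] right_mult_one_mat[OF adj_mat(1)[OF P]])
    also have "\<dots> = (adj_mat (P x) * P x) * Q x"
      by (rule assoc_mult_mat[OF adj_mat(1)[OF P] P Q[OF x], symmetric])
    also have "\<dots> = Determinant.det (P x) \<cdot>\<^sub>m Q x"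
      using Q[OF x] by (simp add: adj_mat(3)[OF P] mult_smult_assoc_mat[of _ n n _ n])
    finally have "cofactor (P x) j i = Determinant.det (P x) * Q x $$ (i, j)"
      using P[of x] Q[OF x] ij by (auto simp: adj_mat_def dest!: arg_cong[where f = "\<lambda>A. A $$ (i, j)"])
    then show ?thesis
      using det[OF x] by (simp add: cofactor_def)
  qed
  moreover have "Ck_on k \<Omega> (\<lambda>x. inverse (Determinant.det (P x)) *
      ((-1) ^ (j + i) * Determinant.det (mat_delete (P x) j i)))"
  proof (intro Ck_on_mult Ck_on_inverse Ck_on_const assms(1) det)
    show "Ck_on k \<Omega> (\<lambda>x. Determinant.det (P x))"
      by (rule Ck_on_det[OF assms(1) P Ck])
    show "Ck_on k \<Omega> (\<lambda>x. Determinant.det (mat_delete (P x) j i))"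
    proof (rule Ck_on_det[OF assms(1), of _ "n - 1"])
      show "mat_delete (P x) j i \<in> carrier_mat (n - 1) (n - 1)" for x
        using P[of x] by (simp add: mat_delete_def)
      fix a b assume ab: "a < n - 1" "b < n - 1"
      have "mat_delete (P x) j i $$ (a, b) = P x $$ (if a < j then a else Suc a, if b < i then b else Suc b)" for x
        using P[of x] ab by (simp add: mat_delete_def)
      then show "Ck_on k \<Omega> (\<lambda>x. mat_delete (P x) j i $$ (a, b))"
        using ab Ck by simp
    qed
  qed
  ultimately show ?thesis
    using Ck_on_cong[OF assms(1)] by (metis (no_types, lifting))
qed

lemma gcoeff_times_empty:
  "gcoeff (a * b :: 'g::{finite,linorder} grassmann) {} = gcoeff a {} * gcoeff b {}"
  by (simp add: gcoeff_times)

text \<open>The coefficients of the inverse are computed by recursion on the monomial: the one of degree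
  zero is the inverse of a complex matrix, and the others follow from \<open>N M = 1\<close> by solving for the
  leading term.\<close>

lemma smooth_on_inverse_mat:
  fixes M N :: "'g::{finite,linorder} smfield"
  assumes \<Omega>: "open \<Omega>"
    and M: "\<And>x. x \<in> \<Omega> \<Longrightarrow> M x \<in> carrier_mat n n" and N: "\<And>x. x \<in> \<Omega> \<Longrightarrow> N x \<in> carrier_mat n n"
    and MN: "\<And>x. x \<in> \<Omega> \<Longrightarrow> M x * N x = 1\<^sub>m n" and NM: "\<And>x. x \<in> \<Omega> \<Longrightarrow> N x * M x = 1\<^sub>m n"
    and sM: "\<And>i j. i < n \<Longrightarrow> j < n \<Longrightarrow> smooth_on \<Omega> (\<lambda>x. M x $$ (i, j))"
    and "i < n" "j < n"
  shows "smooth_on \<Omega> (\<lambda>x. N x $$ (i, j))"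
proof -
  define m where "m = (\<lambda>S x i j. gcoeff (M x $$ (i, j)) S)"
  define c where "c = (\<lambda>S x i j. gcoeff (N x $$ (i, j)) S)"
  have Ckm: "Ck_on k \<Omega> (\<lambda>x. m S x i j)" if "i < n" "j < n" for k S i j
    using sM[OF that] by (simp add: smooth_on_def m_def)
  \<comment> \<open>Taking the coefficient at the empty set is multiplicative, so the degree-zero
    parts of \<open>M x\<close> and \<open>N x\<close> are inverse complex matrices.\<close>
  have body: "(\<Sum>l<n. m {} x i l * c {} x l j) = (if i = j then 1 else 0)" if "x \<in> \<Omega>" "i < n" "j < n" for x i j
    using arg_cong[OF MN[OF that(1)], of "\<lambda>A. gcoeff (A $$ (i, j)) {}"] that
    by (simp add: index_mult_mat_sum[OF M N] gcoeff_times_empty m_def c_def del: index_mult_mat)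
  have Ck0: "Ck_on k \<Omega> (\<lambda>x. c {} x i j)" if ij: "i < n" "j < n" for k i j
  proof -
    have "Ck_on k \<Omega> (\<lambda>x. mat n n (\<lambda>(i, j). c {} x i j) $$ (i, j))"
    proof (rule Ck_on_inverse_mat[OF \<Omega>, where P = "\<lambda>x. mat n n (\<lambda>(i, j). m {} x i j)"])
      show "mat n n (\<lambda>(i, j). m {} x i j) * mat n n (\<lambda>(i, j). c {} x i j) = 1\<^sub>m n" if "x \<in> \<Omega>" for x
        using body[OF that]
        by (intro eq_matI) (simp_all add: scalar_prod_def lessThan_atLeast0)
    qed (use ij Ckm in auto)
    then show ?thesis using ij by simp
  qed
  have "\<forall>i<n. \<forall>j<n. \<forall>k. Ck_on k \<Omega> (\<lambda>x. c S x i j)" for S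
    using finite[of S]
  proof (induction S rule: finite_psubset_induct)
    case (psubset S)
    show ?case
    proof (cases "S = {}")
      case True
      then show ?thesis using Ck0 by simp
    next
      case False
      \<comment> \<open>The part of the \<open>S\<close>-coefficient of \<open>N x * M x\<close>
        with \<open>T \<noteq> S\<close>; it involves \<open>N\<close> only at proper subsets of
        \<open>S\<close>, where the induction hypothesis applies.\<close>
      define R where "R = (\<lambda>x i k. \<Sum>l<n. \<Sum>T\<in>Pow S - {S}. gsign T (S - T) * c T x i l * m (S - T) x l k)"
      have lead: "(\<Sum>l<n. c S x i l * m {} x l k) = - R x i k" if x: "x \<in> \<Omega>" "i < n" "k < n" for x i k
      proof -
        have "(\<Sum>l<n. gcoeff (N x $$ (i, l) * M x $$ (l, k)) S) = 0"
          using arg_cong[OF NM[OF x(1)], of "\<lambda>A. gcoeff (A $$ (i, k)) S"] x False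
          by (simp add: index_mult_mat_sum[OF N M] del: index_mult_mat split: if_splits)
        moreover have "gcoeff (N x $$ (i, l) * M x $$ (l, k)) S = c S x i l * m {} x l k +
            (\<Sum>T\<in>Pow S - {S}. gsign T (S - T) * c T x i l * m (S - T) x l k)" for l
          unfolding gcoeff_times by (subst sum.remove[of _ S]) (auto simp: c_def m_def)
        ultimately show ?thesis
          by (simp add: R_def sum.distrib add_eq_0_iff)
      qed
      \<comment> \<open>Multiplying \<open>lead\<close> on the right by the degree-zero part of
        \<open>N x\<close> isolates the coefficient at \<open>S\<close>.\<close>
      have c_eq: "c S x i j = (\<Sum>k<n. (- 1) * R x i k * c {} x k j)" if x: "x \<in> \<Omega>" "i < n" "j < n" for x i j
      proof -
        have "(\<Sum>k<n. (- 1) * R x i k * c {} x k j) = (\<Sum>k<n. (\<Sum>l<n. c S x i l * m {} x l k) * c {} x k j)"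
          using lead[OF x(1,2)] by (intro sum.cong) simp_all
        also have "\<dots> = (\<Sum>k<n. \<Sum>l<n. c S x i l * (m {} x l k * c {} x k j))"
          by (simp add: sum_distrib_right mult.assoc)
        also have "\<dots> = (\<Sum>l<n. c S x i l * (\<Sum>k<n. m {} x l k * c {} x k j))"
          by (subst sum.swap) (simp add: sum_distrib_left)
        also have "\<dots> = (\<Sum>l<n. if l = j then c S x i l else 0)"
          using body[OF x(1) _ x(3)] by (intro sum.cong) auto
        finally show ?thesis using x by simp
      qed
      show ?thesis
      proof (intro allI impI)
        fix i j k assume ij: "i < n" "j < n"
        have "Ck_on k \<Omega> (\<lambda>x. \<Sum>k<n. (- 1) * R x i k * c {} x k j)"
          unfolding R_def using psubset.IH Ckm Ck0 ij
          by (intro Ck_on_sum Ck_on_mult Ck_on_const \<Omega>) (auto simp: psubset_eq)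
        then show "Ck_on k \<Omega> (\<lambda>x. c S x i j)"
          using Ck_on_cong[OF \<Omega> c_eq] ij by simp
      qed
    qed
  qed
  then show ?thesis
    using assms(7,8) by (simp add: smooth_on_def c_def)
qed

section \<open>The matrix E, parity and inverses of supermatrices\<close>

lemma smooth_mat_onD: "smooth_mat_on \<Omega> p q M \<Longrightarrow> i < p + q \<Longrightarrow> j < p + q \<Longrightarrow> smooth_on \<Omega> (\<lambda>x. M x $$ (i, j))"
  by (simp add: smooth_mat_on_def)

lemma Emat_carrier [simp]: "Emat p q \<in> carrier_mat (p + q) (p + q)"
  by (simp add: Emat_def)

lemma Emat_dim [simp]: "dim_row (Emat p q) = p + q" "dim_col (Emat p q) = p + q"
  by (simp_all add: Emat_def)

lemma Emat_index:
  "i < p + q \<Longrightarrow> j < p + q \<Longrightarrow> Emat p q $$ (i, j) = (if i = j then if i < p then 1 else - 1 else 0)"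
  by (auto simp: Emat_def)

lemma index_Emat_mult:
  fixes M :: "'g::{finite,linorder} grassmann mat"
  assumes "M \<in> carrier_mat (p + q) (p + q)" "i < p + q" "j < p + q"
  shows "(Emat p q * M) $$ (i, j) = (if i < p then M $$ (i, j) else - M $$ (i, j))"
proof -
  have "(Emat p q * M) $$ (i, j) =
      (\<Sum>k<p + q. if i = k then (if i < p then M $$ (i, j) else - M $$ (i, j)) else 0)"
    unfolding index_mult_mat_sum[OF Emat_carrier assms] using assms(2)
    by (intro sum.cong) (auto simp: Emat_index)
  then show ?thesis using assms(2) by simp
qed

lemma index_mult_Emat:
  fixes M :: "'g::{finite,linorder} grassmann mat"
  assumes "M \<in> carrier_mat (p + q) (p + q)" "i < p + q" "j < p + q"
  shows "(M * Emat p q) $$ (i, j) = (if j < p then M $$ (i, j) else - M $$ (i, j))"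
proof -
  have "(M * Emat p q) $$ (i, j) =
      (\<Sum>k<p + q. if k = j then (if j < p then M $$ (i, j) else - M $$ (i, j)) else 0)"
    unfolding index_mult_mat_sum[OF assms(1) Emat_carrier assms(2,3)] using assms(3)
    by (intro sum.cong) (auto simp: Emat_index)
  then show ?thesis using assms(3) by simp
qed

lemma Emat_square: "Emat p q * Emat p q = (1\<^sub>m (p + q) :: 'g::{finite,linorder} grassmann mat)"
  by (rule eq_matI) (auto simp: index_Emat_mult[OF Emat_carrier] Emat_index simp del: index_mult_mat(1))

abbreviation mbar :: "'g grassmann mat \<Rightarrow> 'g grassmann mat" where
  "mbar \<equiv> map_mat gbar"

lemma mbar_mult:
  fixes A B :: "'g::{finite,linorder} grassmann mat"
  assumes "A \<in> carrier_mat n n" "B \<in> carrier_mat n n"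
  shows "mbar (A * B) = mbar A * mbar B"
proof (rule eq_matI)
  fix i j assume "i < dim_row (mbar A * mbar B)" "j < dim_col (mbar A * mbar B)"
  then have ij: "i < n" "j < n" using assms by auto
  then have "mbar (A * B) $$ (i, j) = gbar ((A * B) $$ (i, j))"
    using assms by simp
  also have "\<dots> = (\<Sum>k<n. mbar A $$ (i, k) * mbar B $$ (k, j))"
    unfolding index_mult_mat_sum[OF assms ij] using assms ij by simp
  also have "\<dots> = (mbar A * mbar B) $$ (i, j)"
    using assms ij by (intro index_mult_mat_sum[symmetric]) auto
  finally show "mbar (A * B) $$ (i, j) = (mbar A * mbar B) $$ (i, j)" .
qed (use assms in auto)

lemma mbar_Emat: "mbar (Emat p q) = (Emat p q :: 'g::{finite,linorder} grassmann mat)"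
  by (rule eq_matI) (auto simp: Emat_index)

lemma index_Emat_conj:
  fixes M :: "'g::{finite,linorder} grassmann mat"
  assumes "M \<in> carrier_mat (p + q) (p + q)" "i < p + q" "j < p + q"
  shows "(Emat p q * M * Emat p q) $$ (i, j) = (if i < p \<longleftrightarrow> j < p then M $$ (i, j) else - M $$ (i, j))"
proof -
  have "Emat p q * M \<in> carrier_mat (p + q) (p + q)"
    using mult_carrier_mat[OF Emat_carrier assms(1)] .
  then show ?thesis
    using assms by (simp add: index_mult_Emat index_Emat_mult del: index_mult_mat(1))
qed

lemma bosonic_mat_iff:
  fixes M :: "'g::{finite,linorder} grassmann mat"
  shows "bosonic_mat p q M \<longleftrightarrow> M \<in> carrier_mat (p + q) (p + q) \<and> mbar M = Emat p q * M * Emat p q"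
proof (cases "M \<in> carrier_mat (p + q) (p + q)")
  case True
  have "mbar M = Emat p q * M * Emat p q \<longleftrightarrow>
      (\<forall>i<p + q. \<forall>j<p + q. gbar (M $$ (i, j)) = (Emat p q * M * Emat p q) $$ (i, j))"
    using True by (subst mat_eq_iff) (auto simp: Emat_def simp del: index_mult_mat(1))
  then show ?thesis
    using True by (auto simp: bosonic_mat_def index_Emat_conj even_elem_iff_gbar odd_elem_iff_gbar
        simp del: index_mult_mat(1))
qed (simp add: bosonic_mat_def)

lemma fermionic_mat_iff:
  fixes M :: "'g::{finite,linorder} grassmann mat"
  shows "fermionic_mat p q M \<longleftrightarrow> M \<in> carrier_mat (p + q) (p + q) \<and> mbar M = - (Emat p q * M * Emat p q)"
proof (cases "M \<in> carrier_mat (p + q) (p + q)")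
  case True
  have "mbar M = - (Emat p q * M * Emat p q) \<longleftrightarrow>
      (\<forall>i<p + q. \<forall>j<p + q. gbar (M $$ (i, j)) = - (Emat p q * M * Emat p q) $$ (i, j))"
    using True by (subst mat_eq_iff) (auto simp: Emat_def simp del: index_mult_mat(1))
  then show ?thesis
    using True by (auto simp: fermionic_mat_def index_Emat_conj even_elem_iff_gbar odd_elem_iff_gbar
        simp del: index_mult_mat(1))
qed (simp add: fermionic_mat_def)

text \<open>Two-sided inverses are unique, so the definite description in \<open>mat_inv\<close>
  denotes. The size of an inverse is forced by comparing dimensions in the two products.\<close>

lemma mat_inv:
  fixes M :: "'g::{finite,linorder} grassmann mat"
  assumes M: "M \<in> carrier_mat n n" and "invertible_mat M"
  shows "mat_inv M \<in> carrier_mat n n" "M * mat_inv M = 1\<^sub>m n" "mat_inv M * M = 1\<^sub>m n"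
proof -
  let ?P = "\<lambda>N. N \<in> carrier_mat (dim_row M) (dim_row M) \<and> inverts_mat M N \<and> inverts_mat N M"
  obtain N where N: "inverts_mat M N" "inverts_mat N M"
    using assms(2) by (auto simp: invertible_mat_def)
  have "dim_col N = n"
    using arg_cong[OF N(1)[unfolded inverts_mat_def], of dim_col] M by simp
  moreover have "dim_row N = n"
    using arg_cong[OF N(2)[unfolded inverts_mat_def], of dim_col] M by simp
  ultimately have PN: "?P N"
    using M N by auto
  have "N' = N" if "?P N'" for N'
  proof -
    have N'c: "N' \<in> carrier_mat n n" and Nc: "N \<in> carrier_mat n n"
      using that PN M by auto
    have "N' = N' * (M * N)"
      using N(1) N'c M by (simp add: inverts_mat_def)
    also have "\<dots> = (N' * M) * N"
      using N'c Nc M by (simp add: assoc_mult_mat)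
    also have "\<dots> = N"
      using that Nc N'c by (simp add: inverts_mat_def)
    finally show ?thesis .
  qed
  with PN have "?P (mat_inv M)"
    unfolding mat_inv_def by (rule theI[of ?P])
  then show "mat_inv M \<in> carrier_mat n n" "M * mat_inv M = 1\<^sub>m n" "mat_inv M * M = 1\<^sub>m n"
    using M by (auto simp: inverts_mat_def)
qed

text \<open>Both \<open>mbar\<close> and conjugation by \<open>Emat p q\<close> respect products.
  They agree on \<open>M\<close>, hence on its inverse: one gives a left inverse of
  \<open>mbar M\<close>, the other a right inverse.\<close>

lemma bosonic_mat_inv:
  fixes M :: "'g::{finite,linorder} grassmann mat"
  assumes "GL_mat p q M"
  shows "bosonic_mat p q (mat_inv M)"
proof -
  let ?n = "p + q" and ?E = "Emat p q" and ?N = "mat_inv M"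
  have M: "M \<in> carrier_mat ?n ?n" "mbar M = ?E * M * ?E" and "invertible_mat M"
    using assms by (auto simp: GL_mat_def bosonic_mat_iff)
  note N = mat_inv[OF M(1) this(3)]
  note assoc = assoc_mult_mat[of _ ?n ?n _ ?n _ ?n]
  have c: "?E * ?N * ?E \<in> carrier_mat ?n ?n" "mbar M \<in> carrier_mat ?n ?n" "mbar ?N \<in> carrier_mat ?n ?n"
    using N by (auto simp: M intro!: mult_carrier_mat[of _ ?n ?n _ ?n])
  have EE: "?E * (?E * X) = X" if "X \<in> carrier_mat ?n ?n" for X :: "'g grassmann mat"
    using that by (simp add: assoc[symmetric] Emat_square)
  have NM: "?N * (M * X) = X" if "X \<in> carrier_mat ?n ?n" for X
    using that M N by (simp add: assoc[symmetric])
  have "mbar M * mbar ?N = 1\<^sub>m ?n"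
    using N by (simp add: mbar_mult[OF M(1) N(1), symmetric]) (auto intro!: eq_matI)
  then have "?E * ?N * ?E = (?E * ?N * ?E) * (mbar M * mbar ?N)"
    using c by simp
  also have "\<dots> = mbar ?N"
    using M N c by (simp add: assoc EE NM mult_carrier_mat[of _ ?n ?n _ ?n])
  finally show ?thesis
    using N by (simp add: bosonic_mat_iff)
qed

section \<open>Products and covariant derivatives of supermatrix fields\<close>

lemma smooth_mat_on_mult:
  assumes "open \<Omega>" "smooth_mat_on \<Omega> p q M" "smooth_mat_on \<Omega> p q N"
    and "\<And>x. x \<in> \<Omega> \<Longrightarrow> M x \<in> carrier_mat (p + q) (p + q)" "\<And>x. x \<in> \<Omega> \<Longrightarrow> N x \<in> carrier_mat (p + q) (p + q)"
  shows "smooth_mat_on \<Omega> p q (\<lambda>x. M x * N x :: 'g::{finite,linorder} grassmann mat)"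
  unfolding smooth_mat_on_def
proof (intro allI impI)
  fix i j assume ij: "i < p + q" "j < p + q"
  have "smooth_on \<Omega> (\<lambda>x. \<Sum>k<p + q. M x $$ (i, k) * N x $$ (k, j))"
    using assms(1) ij by (intro smooth_on_sum smooth_on_mult smooth_mat_onD[OF assms(2)] smooth_mat_onD[OF assms(3)]) auto
  then show "smooth_on \<Omega> (\<lambda>x. (M x * N x) $$ (i, j))"
    by (rule smooth_on_cong[OF assms(1), THEN iffD1, rotated])
      (rule index_mult_mat_sum[OF assms(4,5) ij, symmetric])
qed

lemma covD_mat_carrier:
  "M x \<in> carrier_mat n n \<Longrightarrow> covD_mat th j M x \<in> carrier_mat n n"
  by (simp add: covD_mat_def)

lemma index_covD_mat:
  "M x \<in> carrier_mat n n \<Longrightarrow> a < n \<Longrightarrow> b < n \<Longrightarrow> covD_mat th j M x $$ (a, b) = covD th j (\<lambda>y. M y $$ (a, b)) x"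
  by (auto simp: covD_mat_def)

lemma covD_mat_cong:
  assumes "open \<Omega>" "x \<in> \<Omega>" "\<And>y. y \<in> \<Omega> \<Longrightarrow> M y = N y"
  shows "covD_mat th j M x = covD_mat th j N x"
proof -
  have "covD th j (\<lambda>y. M y $$ ab) x = covD th j (\<lambda>y. N y $$ ab) x" for ab
    by (rule covD_cong[OF assms(1,2)]) (simp add: assms(3))
  then show ?thesis
    using assms(2,3) by (simp add: covD_mat_def)
qed

lemma covD_sum:
  assumes "open \<Omega>" "x \<in> \<Omega>" "\<And>i. i \<in> I \<Longrightarrow> smooth_on \<Omega> (f i)"
  shows "covD th j (\<lambda>y. \<Sum>i\<in>I. f i y) x = (\<Sum>i\<in>I. covD th j (f i) x)"
  using assms(3)
proof (induction I rule: infinite_finite_induct)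
  case (insert i I)
  have "smooth_on \<Omega> (\<lambda>y. \<Sum>i\<in>I. f i y)"
    using insert.prems by (intro smooth_on_sum[OF assms(1)]) auto
  moreover have "smooth_on \<Omega> (f i)"
    using insert.prems by simp
  ultimately have "covD th j (\<lambda>y. f i y + (\<Sum>i\<in>I. f i y)) x = covD th j (f i) x + covD th j (\<lambda>y. \<Sum>i\<in>I. f i y) x"
    by (intro covD_add smooth_on_sdifferentiable[OF _ assms(2)])
  then show ?case
    using insert by simp
qed (simp_all add: covD_const)

lemma covD_mat_mult:
  fixes M N :: "'g::{finite,linorder} smfield"
  assumes \<Omega>: "open \<Omega>" "x \<in> \<Omega>" and sm: "smooth_mat_on \<Omega> p q M" "smooth_mat_on \<Omega> p q N"
    and c: "\<And>x. x \<in> \<Omega> \<Longrightarrow> M x \<in> carrier_mat (p + q) (p + q)" "\<And>x. x \<in> \<Omega> \<Longrightarrow> N x \<in> carrier_mat (p + q) (p + q)"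
  shows "covD_mat th j (\<lambda>y. M y * N y) x = covD_mat th j M x * N x + mbar (M x) * covD_mat th j N x"
proof (rule eq_matI)
  let ?n = "p + q"
  note cx = c[OF \<Omega>(2)] and Dc = covD_mat_carrier[of M, OF c(1)[OF \<Omega>(2)]] covD_mat_carrier[of N, OF c(2)[OF \<Omega>(2)]]
  have bc: "mbar (M x) \<in> carrier_mat ?n ?n" using cx by simp
  fix a b assume "a < dim_row (covD_mat th j M x * N x + mbar (M x) * covD_mat th j N x)"
    "b < dim_col (covD_mat th j M x * N x + mbar (M x) * covD_mat th j N x)"
  then have ab: "a < ?n" "b < ?n"
    using cx carrier_matD[OF Dc(1)] carrier_matD[OF Dc(2)] by auto
  have s: "smooth_on \<Omega> (\<lambda>x. M x $$ (a, k))" "smooth_on \<Omega> (\<lambda>x. N x $$ (k, b))" if "k < ?n" for k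
    using sm ab that by (auto simp: smooth_mat_on_def)
  have "covD_mat th j (\<lambda>y. M y * N y) x $$ (a, b) = covD th j (\<lambda>y. (M y * N y) $$ (a, b)) x"
    using ab cx by (intro index_covD_mat[of _ _ ?n]) auto
  also have "\<dots> = covD th j (\<lambda>y. \<Sum>k<?n. M y $$ (a, k) * N y $$ (k, b)) x"
    by (rule covD_cong[OF \<Omega> index_mult_mat_sum[OF c ab]])
  also have "\<dots> = (\<Sum>k<?n. covD th j (\<lambda>y. M y $$ (a, k) * N y $$ (k, b)) x)"
    using s \<Omega> by (intro covD_sum smooth_on_mult) auto
  also have "\<dots> = (\<Sum>k<?n. covD_mat th j M x $$ (a, k) * N x $$ (k, b) + mbar (M x) $$ (a, k) * covD_mat th j N x $$ (k, b))"
    using ab cx s[THEN smooth_on_sdifferentiable, OF _ \<Omega>(2)]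
    by (intro sum.cong refl) (simp add: covD_mult index_covD_mat)
  also have "\<dots> = (covD_mat th j M x * N x) $$ (a, b) + (mbar (M x) * covD_mat th j N x) $$ (a, b)"
    unfolding index_mult_mat_sum[OF Dc(1) cx(2) ab] index_mult_mat_sum[OF bc Dc(2) ab] by (rule sum.distrib)
  finally show "covD_mat th j (\<lambda>y. M y * N y) x $$ (a, b) =
      (covD_mat th j M x * N x + mbar (M x) * covD_mat th j N x) $$ (a, b)"
    using ab cx carrier_matD[OF Dc(2)] by (simp del: index_mult_mat(1))
qed (use c[OF \<Omega>(2)] in \<open>auto simp: covD_mat_def\<close>)

lemma covD_mat_mbar:
  fixes M :: "'g::{finite,linorder} smfield"
  assumes "open \<Omega>" "x \<in> \<Omega>" "smooth_mat_on \<Omega> p q M"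
    and c: "\<And>x. x \<in> \<Omega> \<Longrightarrow> M x \<in> carrier_mat (p + q) (p + q)"
  shows "covD_mat th j (\<lambda>y. mbar (M y)) x = - mbar (covD_mat th j M x)"
proof (rule eq_matI)
  fix a b assume "a < dim_row (- mbar (covD_mat th j M x))" "b < dim_col (- mbar (covD_mat th j M x))"
  then have ab: "a < p + q" "b < p + q" using c[OF assms(2)] by (auto simp: covD_mat_def)
  have "covD_mat th j (\<lambda>y. mbar (M y)) x $$ (a, b) = covD th j (\<lambda>y. mbar (M y) $$ (a, b)) x"
    using c[OF assms(2)] ab by (intro index_covD_mat[of _ _ "p + q"]) auto
  also have "\<dots> = covD th j (\<lambda>y. gbar (M y $$ (a, b))) x"
    by (rule covD_cong[OF assms(1,2)]) (use ab carrier_matD[OF c] in simp)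
  also have "\<dots> = - gbar (covD th j (\<lambda>y. M y $$ (a, b)) x)"
    using smooth_on_sdifferentiable[OF smooth_mat_onD[OF assms(3) ab] assms(2)] by (rule covD_gbar)
  finally show "covD_mat th j (\<lambda>y. mbar (M y)) x $$ (a, b) = (- mbar (covD_mat th j M x)) $$ (a, b)"
    using ab c[OF assms(2)] by (auto simp: covD_mat_def)
qed (use c[OF assms(2)] in \<open>auto simp: covD_mat_def\<close>)

section \<open>Deformations of the linear spectral problem\<close>

text \<open>One value of the spectral parameter and one solution are held fixed, so that all
  functions of the jet become fields on \<open>\<Omega>\<close>.\<close>

locale lsp_deformation =
  fixes p q :: nat and th :: "nat \<Rightarrow> 'g::{finite,linorder}" and \<Omega> :: "point set"
    and U A :: "nat \<Rightarrow> 'g smfield" and \<Psi> :: "'g smfield"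
  assumes theta: "th 1 \<noteq> th 2"
    and \<Omega>: "open \<Omega>" "simply_connected \<Omega>"
    and U: "\<And>j. j \<in> {1, 2} \<Longrightarrow> fermionic_on \<Omega> p q (U j)"
    and A: "\<And>j. j \<in> {1, 2} \<Longrightarrow> fermionic_on \<Omega> p q (A j)"
    and Psi: "GL_on \<Omega> p q \<Psi>"
    and LSP: "LSP \<Omega> p q th U \<Psi>"
    and dZCC: "deformed_ZCC \<Omega> p q th U A"
begin

abbreviation "n \<equiv> p + q"
abbreviation E :: "'g grassmann mat" where "E \<equiv> Emat p q"
abbreviation "\<Phi> x \<equiv> mat_inv (\<Psi> x)"

definition B :: "nat \<Rightarrow> 'g smfield" where
  "B j x = E * (\<Phi> x * E * A j x * \<Psi> x)"

lemma carriers: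
  assumes "x \<in> \<Omega>"
  shows "\<Psi> x \<in> carrier_mat n n" "\<Phi> x \<in> carrier_mat n n"
    "j \<in> {1, 2} \<Longrightarrow> U j x \<in> carrier_mat n n" "j \<in> {1, 2} \<Longrightarrow> A j x \<in> carrier_mat n n"
  using assms Psi U[of j] A[of j]
  by (auto simp: GL_on_def GL_mat_def bosonic_mat_def fermionic_on_def fermionic_mat_def intro: mat_inv)

lemma Psi_inverse: "x \<in> \<Omega> \<Longrightarrow> \<Psi> x * \<Phi> x = 1\<^sub>m n" "x \<in> \<Omega> \<Longrightarrow> \<Phi> x * \<Psi> x = 1\<^sub>m n"
  using Psi mat_inv(2,3)[OF carriers(1)] by (auto simp: GL_on_def GL_mat_def)

lemmas square = mult_carrier_mat[of _ n n _ n]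
lemmas assoc = assoc_mult_mat[of _ n n _ n _ n]

lemma cancel:
  assumes "X \<in> carrier_mat n n"
  shows "E * (E * X) = X" "x \<in> \<Omega> \<Longrightarrow> \<Psi> x * (\<Phi> x * X) = X" "x \<in> \<Omega> \<Longrightarrow> \<Phi> x * (\<Psi> x * X) = X"
  using assms carriers(1,2) by (simp_all add: assoc[symmetric] Emat_square Psi_inverse)

lemma B_carrier: "x \<in> \<Omega> \<Longrightarrow> j \<in> {1, 2} \<Longrightarrow> B j x \<in> carrier_mat n n"
  unfolding B_def using carriers by (intro square) auto

lemma mbar_Psi: "x \<in> \<Omega> \<Longrightarrow> mbar (\<Psi> x) = E * \<Psi> x * E" "x \<in> \<Omega> \<Longrightarrow> mbar (\<Phi> x) = E * \<Phi> x * E"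
  using Psi bosonic_mat_inv by (auto simp: GL_on_def GL_mat_def bosonic_mat_iff)

lemma mbar_UA:
  assumes "x \<in> \<Omega>" "j \<in> {1, 2}"
  shows "mbar (U j x) = - (E * U j x * E)" "mbar (A j x) = - (E * A j x * E)"
  using U[of j] A[of j] assms by (auto simp: fermionic_on_def fermionic_mat_iff)

lemma smooth_UAPsi:
  "j \<in> {1, 2} \<Longrightarrow> smooth_mat_on \<Omega> p q (U j)" "j \<in> {1, 2} \<Longrightarrow> smooth_mat_on \<Omega> p q (A j)"
  "smooth_mat_on \<Omega> p q \<Psi>"
  using U[of j] A[of j] Psi by (auto simp: fermionic_on_def GL_on_def)

lemma smooth_Phi: "smooth_mat_on \<Omega> p q \<Phi>"
  unfolding smooth_mat_on_def
proof (intro allI impI)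
  fix i j assume ij: "i < n" "j < n"
  show "smooth_on \<Omega> (\<lambda>x. \<Phi> x $$ (i, j))"
    by (rule smooth_on_inverse_mat[where M = \<Psi> and n = n, OF \<Omega>(1)])
      (assumption | rule carriers(1,2) Psi_inverse smooth_mat_onD[OF smooth_UAPsi(3)] ij)+
qed

lemma smooth_B: "j \<in> {1, 2} \<Longrightarrow> smooth_mat_on \<Omega> p q (B j)"
proof -
  assume j: "j \<in> {1, 2}"
  have E: "smooth_mat_on \<Omega> p q (\<lambda>x. E)"
    by (simp add: smooth_mat_on_def smooth_on_const \<Omega>(1))
  note c = Emat_carrier carriers(1,2) carriers(4)[OF _ j]
  show ?thesis
    unfolding B_def
    by (rule smooth_mat_on_mult[OF \<Omega>(1)] E smooth_Phi smooth_UAPsi(2)[OF j] smooth_UAPsi(3) square c | assumption)+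
qed

text \<open>The factors \<open>E\<close> cancel in pairs. This is the order-epsilon part of the
  deformed LSP after the terms with \<open>U\<close> have cancelled.\<close>

lemma mbar_Psi_B:
  assumes "x \<in> \<Omega>" "j \<in> {1, 2}"
  shows "mbar (\<Psi> x) * B j x = A j x * \<Psi> x"
  using carriers[OF assms(1)] assms(2)
  by (simp add: B_def mbar_Psi[OF assms(1)] assoc square cancel assms(1) del: insert_iff)

text \<open>\<open>B j\<close> is fermionic, which supplies the parity of each entry when the
  potentials are constructed.\<close>

lemma mbar_B:
  assumes "x \<in> \<Omega>" "j \<in> {1, 2}"
  shows "mbar (B j x) = - (E * B j x * E)"
proof -
  note c = carriers[OF assms(1)] carriers(3,4)[OF assms]
  have "mbar (B j x) = E * (E * \<Phi> x * E * E * (- (E * A j x * E)) * (E * \<Psi> x * E))"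
    using c by (simp add: B_def mbar_mult[of _ n] square mbar_Emat mbar_Psi[OF assms(1)] mbar_UA[OF assms])
  also have "\<dots> = - (\<Phi> x * E * A j x * \<Psi> x * E)"
    using c by (simp add: assoc square cancel uminus_mult_left_mat uminus_mult_right_mat assms(1))
  also have "\<dots> = - (E * B j x * E)"
    using c by (simp add: B_def assoc square cancel assms(1))
  finally show ?thesis .
qed

lemma covD_Psi:
  assumes "x \<in> \<Omega>" "j \<in> {1, 2}"
  shows "covD_mat th j \<Psi> x = U j x * \<Psi> x"
proof -
  have c: "covD_mat th j \<Psi> x \<in> carrier_mat n n" "U j x * \<Psi> x \<in> carrier_mat n n"
    using carriers[OF assms(1)] carriers(3)[OF assms] covD_mat_carrier[of \<Psi> x n] by (auto intro: square)
  have 0: "covD_mat th j \<Psi> x - U j x * \<Psi> x = 0\<^sub>m n n"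
    using LSP assms by (auto simp: LSP_def)
  have "covD_mat th j \<Psi> x $$ (a, b) - (U j x * \<Psi> x) $$ (a, b) = 0" if "a < n" "b < n" for a b
    using arg_cong[OF 0, of "\<lambda>M. M $$ (a, b)"] that carrier_matD[OF c(2)]
    by (simp del: index_mult_mat)
  then show ?thesis
    using carrier_matD[OF c(1)] carrier_matD[OF c(2)]
    by (intro eq_matI) (simp_all del: index_mult_mat)
qed

text \<open>Differentiating \<open>(E \<Psi> E) B\<^sub>j = A\<^sub>j \<Psi>\<close> avoids the derivative of \<open>\<Psi>\<^sup>-\<^sup>1\<close>.\<close>

lemma Psi_covD_B:
  assumes x: "x \<in> \<Omega>" and jk: "j \<in> {1, 2}" "k \<in> {1, 2}"
  shows "\<Psi> x * covD_mat th k (B j) x =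
    (covD_mat th k (A j) x - (E * A j x) * (E * U k x) - (E * U k x) * (E * A j x)) * \<Psi> x"
proof -
  note c = carriers(1,2)[OF x] carriers(3)[OF x jk(2)] carriers(4)[OF x jk(1)] B_carrier[OF x jk(1)]
  have cD: "covD_mat th k (B j) x \<in> carrier_mat n n" "covD_mat th k (A j) x \<in> carrier_mat n n"
    by (intro covD_mat_carrier c)+
  have cm: "mbar (\<Psi> y) \<in> carrier_mat n n" if "y \<in> \<Omega>" for y
    using carriers(1)[OF that] by simp
  have sm: "smooth_mat_on \<Omega> p q (\<lambda>y. mbar (\<Psi> y))"
    unfolding smooth_mat_on_def
  proof (intro allI impI)
    fix a b assume ab: "a < n" "b < n"
    have "smooth_on \<Omega> (\<lambda>y. gbar (\<Psi> y $$ (a, b)))"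
      using smooth_mat_onD[OF smooth_UAPsi(3) ab] by (rule smooth_on_glinear[OF \<Omega>(1)]) (rule glinear_intros)
    then show "smooth_on \<Omega> (\<lambda>y. mbar (\<Psi> y) $$ (a, b))"
      by (rule smooth_on_cong[OF \<Omega>(1), THEN iffD1, rotated]) (use ab carrier_matD[OF carriers(1)] in simp)
  qed
  have "covD_mat th k (\<lambda>y. mbar (\<Psi> y) * B j y) x = covD_mat th k (\<lambda>y. A j y * \<Psi> y) x"
    by (rule covD_mat_cong[OF \<Omega>(1) x]) (rule mbar_Psi_B[OF _ jk(1)])
  moreover have "covD_mat th k (\<lambda>y. mbar (\<Psi> y) * B j y) x =
      covD_mat th k (\<lambda>y. mbar (\<Psi> y)) x * B j x + mbar (mbar (\<Psi> x)) * covD_mat th k (B j) x"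
    by (rule covD_mat_mult[OF \<Omega>(1) x sm smooth_B[OF jk(1)] cm B_carrier[OF _ jk(1)]])
  moreover have "mbar (mbar (\<Psi> x)) = \<Psi> x"
    by (rule eq_matI) auto
  \<comment> \<open>Two minus signs cancel: one from \<open>covD_mat\<close> passing
    \<open>mbar\<close>, one from \<open>U k\<close> being fermionic. Then \<open>mbar_Psi_B\<close>
    replaces the product with \<open>B j\<close>.\<close>
  moreover have "covD_mat th k (\<lambda>y. mbar (\<Psi> y)) x * B j x = (E * U k x) * (E * A j x) * \<Psi> x"
  proof -
    have "covD_mat th k (\<lambda>y. mbar (\<Psi> y)) x = - mbar (U k x * \<Psi> x)"
      using covD_mat_mbar[OF \<Omega>(1) x smooth_UAPsi(3) carriers(1)] covD_Psi[OF x jk(2)] by simp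
    also have "\<dots> = E * U k x * E * mbar (\<Psi> x)"
      using c cm[OF x] by (simp add: mbar_mult[of _ n] mbar_UA[OF x jk(2)] uminus_mult_left_mat square)
    finally show ?thesis
      using c cm[OF x] mbar_Psi_B[OF x jk(1)] by (simp add: assoc square)
  qed
  moreover have "covD_mat th k (\<lambda>y. A j y * \<Psi> y) x =
      covD_mat th k (A j) x * \<Psi> x - (E * A j x) * (E * U k x) * \<Psi> x"
  proof -
    have "covD_mat th k (\<lambda>y. A j y * \<Psi> y) x = covD_mat th k (A j) x * \<Psi> x + mbar (A j x) * covD_mat th k \<Psi> x"
      by (rule covD_mat_mult[OF \<Omega>(1) x smooth_UAPsi(2)[OF jk(1)] smooth_UAPsi(3) carriers(4)[OF _ jk(1)] carriers(1)])
    also have "mbar (A j x) * covD_mat th k \<Psi> x = - ((E * A j x) * (E * U k x) * \<Psi> x)"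
      using c by (simp add: mbar_UA[OF x jk(1)] covD_Psi[OF x jk(2)] uminus_mult_left_mat square assoc)
    finally show ?thesis
      using c cD by (simp add: add_uminus_minus_mat[of _ n n] square)
  qed
  ultimately have *: "(E * U k x) * (E * A j x) * \<Psi> x + \<Psi> x * covD_mat th k (B j) x =
      covD_mat th k (A j) x * \<Psi> x - (E * A j x) * (E * U k x) * \<Psi> x"
    by simp
  have c2: "(E * U k x) * (E * A j x) \<in> carrier_mat n n" "(E * A j x) * (E * U k x) \<in> carrier_mat n n"
    using c by (auto intro!: square)
  have "\<Psi> x * covD_mat th k (B j) x = covD_mat th k (A j) x * \<Psi> x - (E * A j x) * (E * U k x) * \<Psi> x
      - (E * U k x) * (E * A j x) * \<Psi> x" (is "?L = ?R")
  proof (rule eq_matI)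
    fix a b assume "a < dim_row ?R" "b < dim_col ?R"
    then have ab: "a < n" "b < n" using c by auto
    from arg_cong[OF *, of "\<lambda>M. M $$ (a, b)"] show "?L $$ (a, b) = ?R $$ (a, b)"
      using c cD c2 ab by (simp add: algebra_simps del: index_mult_mat(1))
  qed (use c cD c2 in auto)
  also have "\<dots> = (covD_mat th k (A j) x - (E * A j x) * (E * U k x) - (E * U k x) * (E * A j x)) * \<Psi> x"
    by (simp only: minus_mult_distrib_mat[OF minus_carrier_mat[OF c2(2)] c2(1) c(1)]
        minus_mult_distrib_mat[OF cD(2) c2(2) c(1)])
  finally show ?thesis .
qed

lemma diff_add_diff_mat:
  fixes X :: "'g grassmann mat"
  assumes "C \<in> carrier_mat n n" "D \<in> carrier_mat n n" "X \<in> carrier_mat n n" "Y \<in> carrier_mat n n"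
    "Z \<in> carrier_mat n n" "W \<in> carrier_mat n n"
  shows "C - X - Y + (D - Z - W) = C + D - (Z + W) - (X + Y)"
  using assms by (intro eq_matI) auto

lemma compatible:
  assumes x: "x \<in> \<Omega>"
  shows "covD_mat th 1 (B 2) x + covD_mat th 2 (B 1) x = 0\<^sub>m n n"
proof -
  note c = carriers(1,2)[OF x] carriers(3,4)[OF x, of 1] carriers(3,4)[OF x, of 2]
    B_carrier[OF x, of 1] B_carrier[OF x, of 2]
  have cD: "covD_mat th k (B 1) x \<in> carrier_mat n n" "covD_mat th k (A 1) x \<in> carrier_mat n n"
    "covD_mat th k (B 2) x \<in> carrier_mat n n" "covD_mat th k (A 2) x \<in> carrier_mat n n" for k
    by (rule covD_mat_carrier, use c in simp)+
  \<comment> \<open>\<open>?W1\<close> pairs \<open>A 2\<close> with \<open>U 1\<close> and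
    \<open>?W2\<close> pairs \<open>A 1\<close> with \<open>U 2\<close>; their sum regroups into the
    two anticommutators of the deformed ZCC.\<close>
  let ?W1 = "covD_mat th 1 (A 2) x - (E * A 2 x) * (E * U 1 x) - (E * U 1 x) * (E * A 2 x)"
  let ?W2 = "covD_mat th 2 (A 1) x - (E * A 1 x) * (E * U 2 x) - (E * U 2 x) * (E * A 1 x)"
  let ?Z = "covD_mat th 1 (A 2) x + covD_mat th 2 (A 1) x - acomm (E * A 1 x) (E * U 2 x) - acomm (E * A 2 x) (E * U 1 x)"
  have c2: "(E * A i x) * (E * U k x) \<in> carrier_mat n n" "(E * U k x) * (E * A i x) \<in> carrier_mat n n"
    if "i \<in> {1, 2}" "k \<in> {1, 2}" for i k
    using c that by (auto intro!: square)
  have W: "?W1 \<in> carrier_mat n n" "?W2 \<in> carrier_mat n n"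
    using cD c2 by (auto intro!: minus_carrier_mat)
  have "?W1 + ?W2 = ?Z"
    unfolding acomm_def by (rule diff_add_diff_mat) (use cD c2 in simp_all)
  also have "\<dots> = 0\<^sub>m n n"
    using dZCC x by (auto simp: deformed_ZCC_def)
  finally have 0: "?W1 + ?W2 = 0\<^sub>m n n" .
  have "\<Psi> x * (covD_mat th 1 (B 2) x + covD_mat th 2 (B 1) x) =
      \<Psi> x * covD_mat th 1 (B 2) x + \<Psi> x * covD_mat th 2 (B 1) x"
    using c cD by (simp add: mult_add_distrib_mat[of _ n n _ n])
  also have "\<dots> = (?W1 + ?W2) * \<Psi> x"
    using c W by (simp add: Psi_covD_B[OF x] add_mult_distrib_mat[of _ n n _ _ n])
  also have "\<dots> = 0\<^sub>m n n"
    unfolding 0 using c by simp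
  finally have "\<Psi> x * (covD_mat th 1 (B 2) x + covD_mat th 2 (B 1) x) = 0\<^sub>m n n" .
  then have "\<Phi> x * (\<Psi> x * (covD_mat th 1 (B 2) x + covD_mat th 2 (B 1) x)) = 0\<^sub>m n n"
    using c by simp
  then show ?thesis
    using cD by (simp add: cancel(3)[OF _ x])
qed

text \<open>The equations decouple into scalar ones, since \<open>covD_mat\<close> acts entrywise.
  The sign \<open>s a b\<close> asks for even entries in the diagonal blocks and odd ones
  elsewhere.\<close>

lemma potential_exists:
  "\<exists>F. bosonic_on \<Omega> p q F \<and> (\<forall>j\<in>{1, 2}. \<forall>x\<in>\<Omega>. covD_mat th j F x = B j x)"
proof -
  define s :: "nat \<Rightarrow> nat \<Rightarrow> complex" where "s a b = (if a < p \<longleftrightarrow> b < p then 1 else - 1)" for a b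
  define good where "good a b f \<longleftrightarrow> smooth_on \<Omega> f \<and>
      (\<forall>x\<in>\<Omega>. covD th 1 f x = B 1 x $$ (a, b) \<and> covD th 2 f x = B 2 x $$ (a, b)) \<and>
      (\<forall>x. gbar (f x) = gconst (s a b) * f x)" for a b f
  have ex: "\<exists>f. good a b f" if ab: "a < n" "b < n" for a b
    unfolding good_def
  proof (rule covD_potential_parity[where th = th, OF theta \<Omega>])
    show "smooth_on \<Omega> (\<lambda>x. B 1 x $$ (a, b))" "smooth_on \<Omega> (\<lambda>x. B 2 x $$ (a, b))"
      by (intro smooth_mat_onD[OF smooth_B ab]; simp)+
    show "s a b * s a b = 1" by (simp add: s_def)
    have "gbar (B j x $$ (a, b)) = - gconst (s a b) * B j x $$ (a, b)" if "x \<in> \<Omega>" "j \<in> {1, 2}" for x j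
    proof -
      note Bc = B_carrier[OF that]
      have "gbar (B j x $$ (a, b)) = mbar (B j x) $$ (a, b)"
        using Bc ab by simp
      also have "\<dots> = - ((E * B j x * E) $$ (a, b))"
        unfolding mbar_B[OF that] using Bc ab by (simp del: index_mult_mat(1))
      finally show ?thesis
        by (simp add: index_Emat_conj[OF Bc ab] s_def gconst_minus_1)
    qed
    then show "gbar (B 1 x $$ (a, b)) = - gconst (s a b) * B 1 x $$ (a, b)"
      "gbar (B 2 x $$ (a, b)) = - gconst (s a b) * B 2 x $$ (a, b)" if "x \<in> \<Omega>" for x
      using that by simp_all
    fix x assume x: "x \<in> \<Omega>"
    have c: "B 1 x \<in> carrier_mat n n" "B 2 x \<in> carrier_mat n n"
      using B_carrier[OF x] by simp_all
    have "(covD_mat th 1 (B 2) x + covD_mat th 2 (B 1) x) $$ (a, b) = 0"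
      using compatible[OF x] ab by simp
    then show "covD th 1 (\<lambda>y. B 2 y $$ (a, b)) x + covD th 2 (\<lambda>y. B 1 y $$ (a, b)) x = 0"
      using ab c carrier_matD[OF covD_mat_carrier[of "B 1", OF c(1)]]
      by (simp add: index_covD_mat[of _ _ n])
  qed
  define f where "f a b = (SOME f. good a b f)" for a b
  have "good a b (f a b)" if "a < n" "b < n" for a b
    unfolding f_def by (rule someI_ex[OF ex[OF that]])
  then have f: "\<And>a b. a < n \<Longrightarrow> b < n \<Longrightarrow> smooth_on \<Omega> (f a b)"
    "\<And>a b x. a < n \<Longrightarrow> b < n \<Longrightarrow> x \<in> \<Omega> \<Longrightarrow> covD th 1 (f a b) x = B 1 x $$ (a, b)"
    "\<And>a b x. a < n \<Longrightarrow> b < n \<Longrightarrow> x \<in> \<Omega> \<Longrightarrow> covD th 2 (f a b) x = B 2 x $$ (a, b)"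
    "\<And>a b x. a < n \<Longrightarrow> b < n \<Longrightarrow> gbar (f a b x) = gconst (s a b) * f a b x"
    unfolding good_def by blast+
  define F where "F x = mat n n (\<lambda>(a, b). f a b x)" for x
  have "bosonic_on \<Omega> p q F"
    using f(1,4) by (auto simp: bosonic_on_def smooth_mat_on_def bosonic_mat_def F_def
        even_elem_iff_gbar odd_elem_iff_gbar s_def gconst_minus_1)
  moreover have "covD_mat th j F x = B j x" if "j \<in> {1, 2}" "x \<in> \<Omega>" for j x
  proof (rule eq_matI)
    note Bc = B_carrier[OF that(2,1)]
    have Fc: "F x \<in> carrier_mat n n" by (simp add: F_def)
    fix a b assume "a < dim_row (B j x)" "b < dim_col (B j x)"
    then have ab: "a < n" "b < n" using Bc by auto
    then have "(\<lambda>y. F y $$ (a, b)) = f a b" by (simp add: F_def fun_eq_iff)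
    then show "covD_mat th j F x $$ (a, b) = B j x $$ (a, b)"
      using that f(2,3)[OF ab that(2)] by (auto simp: index_covD_mat[of F, OF Fc ab])
  qed (use B_carrier[OF that(2,1)] in \<open>auto simp: covD_mat_def F_def\<close>)
  ultimately show ?thesis by blast
qed

lemma tangent_rhs_eq:
  assumes "x \<in> \<Omega>" "j \<in> {1, 2}"
  shows "E * B j x = tangent_rhs p q \<Psi> (A j) x"
  using carriers[OF assms(1)] carriers(4)[OF assms]
  by (simp add: B_def tangent_rhs_def cancel square)

lemma deformed_LSP_potential:
  assumes F: "bosonic_on \<Omega> p q F" and D: "\<And>j x. j \<in> {1, 2} \<Longrightarrow> x \<in> \<Omega> \<Longrightarrow> covD_mat th j F x = B j x"
  shows "deformed_LSP \<Omega> p q th U A \<Psi> F"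
  unfolding deformed_LSP_def Let_def eps_eq_on_def eps_covD_def eps_mult_def fst_conv snd_conv
proof (intro ballI conjI)
  fix j :: nat and x assume j: "j \<in> {1, 2}" and x: "x \<in> \<Omega>"
  have Fc: "F y \<in> carrier_mat n n" if "y \<in> \<Omega>" for y
    using F that by (auto simp: bosonic_on_def bosonic_mat_def)
  note c = carriers(1,2)[OF x] carriers(3)[OF x j] carriers(4)[OF x j] B_carrier[OF x j] Fc[OF x]
  have "covD_mat th j (\<lambda>y. \<Psi> y * 1\<^sub>m n) x = covD_mat th j \<Psi> x"
    by (rule covD_mat_cong[OF \<Omega>(1) x]) (rule right_mult_one_mat[OF carriers(1)])
  then show "covD_mat th j (\<lambda>y. \<Psi> y * 1\<^sub>m n) x = U j x * (\<Psi> x * 1\<^sub>m n)"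
    using c by (simp add: covD_Psi[OF x j])
  \<comment> \<open>The summand \<open>0\<^sub>m n n * 1\<^sub>m n\<close> is the zero epsilon part
    of \<open>\<Psi>\<close> multiplied by the leading part of I + epsilon F.\<close>
  have "covD_mat th j (\<lambda>y. \<Psi> y * F y + 0\<^sub>m n n * 1\<^sub>m n) x = covD_mat th j (\<lambda>y. \<Psi> y * F y) x"
    by (rule covD_mat_cong[OF \<Omega>(1) x]) (simp add: right_add_zero_mat[OF square] carriers(1) Fc)
  also have "\<dots> = covD_mat th j \<Psi> x * F x + mbar (\<Psi> x) * covD_mat th j F x"
    using F by (intro covD_mat_mult[OF \<Omega>(1) x smooth_UAPsi(3) _ carriers(1) Fc]) (auto simp: bosonic_on_def)
  also have "\<dots> = U j x * \<Psi> x * F x + A j x * \<Psi> x"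
    by (simp add: covD_Psi[OF x j] D[OF j x] mbar_Psi_B[OF x j])
  also have "\<dots> = U j x * (\<Psi> x * F x + 0\<^sub>m n n * 1\<^sub>m n) + A j x * (\<Psi> x * 1\<^sub>m n)"
    using c by (simp add: right_add_zero_mat[OF square] assoc)
  finally show "covD_mat th j (\<lambda>y. \<Psi> y * F y + 0\<^sub>m n n * 1\<^sub>m n) x =
      U j x * (\<Psi> x * F x + 0\<^sub>m n n * 1\<^sub>m n) + A j x * (\<Psi> x * 1\<^sub>m n)" .
qed

text \<open>The tangent map is additive in its coefficients, so two arguments with the same image
  yield a vanishing combination whose coefficients are their differences.\<close>

lemma immersed_surface_potential:
  assumes F: "bosonic_on \<Omega> p q F" and D: "\<And>j x. j \<in> {1, 2} \<Longrightarrow> x \<in> \<Omega> \<Longrightarrow> tangent_vector p q th j F x = tangent_rhs p q \<Psi> (A j) x"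
    and indep: "\<And>x. x \<in> \<Omega> \<Longrightarrow> lin_indep2 n (tangent_rhs p q \<Psi> (A 1) x) (tangent_rhs p q \<Psi> (A 2) x)"
  shows "immersed_surface \<Omega> p q th F"
  unfolding immersed_surface_def
proof (intro conjI F ballI injI)
  fix x and a b :: "'g grassmann \<times> 'g grassmann"
  assume x: "x \<in> \<Omega>" and eq: "tangent_map p q th F x a = tangent_map p q th F x b"
  let ?V = "tangent_rhs p q \<Psi> (A 1) x" and ?W = "tangent_rhs p q \<Psi> (A 2) x"
  have V: "?V \<in> carrier_mat n n" "?W \<in> carrier_mat n n"
    using carriers(1,2)[OF x] carriers(4)[OF x, of 1] carriers(4)[OF x, of 2] by (auto simp: tangent_rhs_def intro!: square)
  obtain a1 a2 b1 b2 where ab: "a = (a1, a2)" "b = (b1, b2)" by fastforce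
  have "a1 \<cdot>\<^sub>m ?V + a2 \<cdot>\<^sub>m ?W = b1 \<cdot>\<^sub>m ?V + b2 \<cdot>\<^sub>m ?W"
    using eq D[OF _ x] by (simp add: tangent_map_def ab)
  then have "a1 * ?V $$ (i, j) + a2 * ?W $$ (i, j) = b1 * ?V $$ (i, j) + b2 * ?W $$ (i, j)"
    if "i < n" "j < n" for i j
    using V that by (auto dest: arg_cong[where f = "\<lambda>M. M $$ (i, j)"])
  then have "(a1 - b1) \<cdot>\<^sub>m ?V + (a2 - b2) \<cdot>\<^sub>m ?W = 0\<^sub>m n n"
    using V by (intro eq_matI) (simp_all add: left_diff_distrib algebra_simps)
  then show "a = b"
    using indep[OF x] unfolding lin_indep2_def ab by (metis eq_iff_diff_eq_0)
qed

lemma immersion_exists: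
  "\<exists>F. bosonic_on \<Omega> p q F \<and> deformed_LSP \<Omega> p q th U A \<Psi> F \<and>
    (\<forall>j\<in>{1, 2}. \<forall>x\<in>\<Omega>. tangent_vector p q th j F x = tangent_rhs p q \<Psi> (A j) x) \<and>
    ((\<forall>x\<in>\<Omega>. lin_indep2 n (tangent_rhs p q \<Psi> (A 1) x) (tangent_rhs p q \<Psi> (A 2) x)) \<longrightarrow>
      immersed_surface \<Omega> p q th F)"
proof -
  obtain F where F: "bosonic_on \<Omega> p q F" "\<And>j x. j \<in> {1, 2} \<Longrightarrow> x \<in> \<Omega> \<Longrightarrow> covD_mat th j F x = B j x"
    using potential_exists by blast
  then have T: "tangent_vector p q th j F x = tangent_rhs p q \<Psi> (A j) x" if "j \<in> {1, 2}" "x \<in> \<Omega>" for j x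
    using that tangent_rhs_eq by (simp add: tangent_vector_def)
  then show ?thesis
    using F deformed_LSP_potential[OF F] immersed_surface_potential[OF F(1) T] by blast
qed

end

text \<open>\<open>U\<close> and \<open>A\<close> are functions of the jet, whereas
  \<open>\<Psi>\<close> and \<open>F\<close> take the whole field configuration: a potential
  obtained by integration need not be determined by the jet at one point.\<close>

theorem proposition1:
  fixes p q :: nat
    and th :: "nat \<Rightarrow> 'g::{finite,linorder}"
    and \<Omega> :: "(real \<times> real) set"
    and \<Lambda> :: "'l set"
    and fermi :: "'k \<Rightarrow> bool"
    and \<Delta> :: "'e \<Rightarrow> ('k, 'g) jet \<Rightarrow> 'g grassmann"
    and U A :: "nat \<Rightarrow> 'l \<Rightarrow> ('k, 'g) jet \<Rightarrow> 'g grassmann mat"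
    and \<Psi> :: "'l \<Rightarrow> ('k \<Rightarrow> 'g sfield) \<Rightarrow> 'g smfield"
  assumes theta: "th 1 \<noteq> th 2"
    and domain: "open \<Omega>" "simply_connected \<Omega>"
    and U: "\<And>j l u. j \<in> {1, 2} \<Longrightarrow> l \<in> \<Lambda> \<Longrightarrow> u \<in> field_configs \<Omega> fermi \<Longrightarrow>
              fermionic_on \<Omega> p q (along th u (U j l))"
    and zcc: "\<And>l u. l \<in> \<Lambda> \<Longrightarrow> u \<in> field_configs \<Omega> fermi \<Longrightarrow>
              ZCC \<Omega> p q th (\<lambda>j. along th u (U j l)) \<longleftrightarrow> solves \<Omega> th \<Delta> u"
    and Psi: "\<And>l u. l \<in> \<Lambda> \<Longrightarrow> u \<in> field_configs \<Omega> fermi \<Longrightarrow> solves \<Omega> th \<Delta> u \<Longrightarrow>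
              GL_on \<Omega> p q (\<Psi> l u)"
    and lsp: "\<And>l u. l \<in> \<Lambda> \<Longrightarrow> u \<in> field_configs \<Omega> fermi \<Longrightarrow> solves \<Omega> th \<Delta> u \<Longrightarrow>
              LSP \<Omega> p q th (\<lambda>j. along th u (U j l)) (\<Psi> l u)"
    and A: "\<And>j l u. j \<in> {1, 2} \<Longrightarrow> l \<in> \<Lambda> \<Longrightarrow> u \<in> field_configs \<Omega> fermi \<Longrightarrow> solves \<Omega> th \<Delta> u \<Longrightarrow>
              fermionic_on \<Omega> p q (along th u (A j l))"
    and dzcc: "\<And>l u. l \<in> \<Lambda> \<Longrightarrow> u \<in> field_configs \<Omega> fermi \<Longrightarrow> solves \<Omega> th \<Delta> u \<Longrightarrow>
              deformed_ZCC \<Omega> p q th (\<lambda>j. along th u (U j l)) (\<lambda>j. along th u (A j l))"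
  shows "\<exists>F :: 'l \<Rightarrow> ('k \<Rightarrow> 'g sfield) \<Rightarrow> 'g smfield.
    \<forall>l\<in>\<Lambda>. \<forall>u\<in>field_configs \<Omega> fermi. solves \<Omega> th \<Delta> u \<longrightarrow>
      bosonic_on \<Omega> p q (F l u) \<and>
      deformed_LSP \<Omega> p q th (\<lambda>j. along th u (U j l)) (\<lambda>j. along th u (A j l)) (\<Psi> l u) (F l u) \<and>
      (\<forall>j\<in>{1, 2}. \<forall>x\<in>\<Omega>.
         tangent_vector p q th j (F l u) x = tangent_rhs p q (\<Psi> l u) (along th u (A j l)) x) \<and>
      ((\<forall>x\<in>\<Omega>. lin_indep2 (p + q) (tangent_rhs p q (\<Psi> l u) (along th u (A 1 l)) x)
                                   (tangent_rhs p q (\<Psi> l u) (along th u (A 2 l)) x)) \<longrightarrow>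
        immersed_surface \<Omega> p q th (F l u))"
proof -
  let ?good = "\<lambda>l u F. bosonic_on \<Omega> p q F \<and>
      deformed_LSP \<Omega> p q th (\<lambda>j. along th u (U j l)) (\<lambda>j. along th u (A j l)) (\<Psi> l u) F \<and>
      (\<forall>j\<in>{1, 2}. \<forall>x\<in>\<Omega>.
         tangent_vector p q th j F x = tangent_rhs p q (\<Psi> l u) (along th u (A j l)) x) \<and>
      ((\<forall>x\<in>\<Omega>. lin_indep2 (p + q) (tangent_rhs p q (\<Psi> l u) (along th u (A 1 l)) x)
                                   (tangent_rhs p q (\<Psi> l u) (along th u (A 2 l)) x)) \<longrightarrow>
        immersed_surface \<Omega> p q th F)"
  have "\<exists>F. ?good l u F" if "l \<in> \<Lambda>" "u \<in> field_configs \<Omega> fermi" "solves \<Omega> th \<Delta> u" for l u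
  proof -
    interpret lsp_deformation p q th \<Omega> "\<lambda>j. along th u (U j l)" "\<lambda>j. along th u (A j l)" "\<Psi> l u"
      by (unfold_locales; intro theta domain U A Psi lsp dzcc that; assumption)
    show ?thesis by (rule immersion_exists)
  qed
  note ex = this
  \<comment> \<open>The surfaces found for the individual pairs of parameter and solution are
    collected by choice.\<close>
  show ?thesis
    by (rule exI[of _ "\<lambda>l u. SOME F. ?good l u F"], intro ballI impI) (rule someI_ex[OF ex])
qed

end
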